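(* Let $\alpha\in(1,+\infty]$. For $\|\cdot\|_{C^\alpha}$-generic $f\in\mathcal{E}^\alpha$ (i.e. for all $f$ in some residual subset of $(\mathcal{E}^\alpha,\|\cdot\|_{C^\alpha})$) and for every $K\in\mathcal{K}_D$ with $\dim_H(K)<\frac12$, one has $$f(K)\cap K=\varnothing .$$
   Context: $[0,1)$ denotes the circle, i.e. the unit interval with $0$ and $1$ identified, with the metric $d_{[0,1)}(t,s)=\min\{|t-s|,1-|t-s|\}$. $D(x)=2x\pmod 1$ is the doubling map. $\mathcal{K}_D$ is the set of all non-empty compact subsets $K$ of the circle that are invariant under $D$, i.e. $D(K)\subseteq K$. $\dim_H$ is Hausdorff dimension. An expanding Markov map of the circle of class $C^\alpha$ is a local homeomorphism $f:[0,1)\to[0,1)$ of the circle for which there are finitely many cyclically ordered points $x_i$ such that $f$ maps each fundamental interval $[x_{i-1},x_i)$ bijectively onto the circle, $f$ is of class $C^\alpha$ on $(x_{i-1},x_i)$, and there is $\gamma>1$ with $|f'(x)|>\gamma$ for all $x$. $\mathcal{E}^\alpha$ is the set of all $C^\alpha$ expanding Markov maps of the circle, endowed with the usual $C^\alpha$ norm $\|\cdot\|_{C^\alpha}$ (distance $\|f-g\|_{C^\alpha}$). A residual subset is one containing a countable intersection of open dense sets. *)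

theory Defs
  imports "HOL-Analysis.Analysis"
begin

section \<open>The circle\<close>

typedef circle = "{0..<1::real}"
  by (auto intro: exI[of _ 0])

instantiation circle :: metric_space
begin

definition dist_circle :: "circle \<Rightarrow> circle \<Rightarrow> real" where
  "dist_circle s t = min \<bar>Rep_circle s - Rep_circle t\<bar> (1 - \<bar>Rep_circle s - Rep_circle t\<bar>)"

definition uniformity_circle :: "(circle \<times> circle) filter" where
  "uniformity_circle = (INF e\<in>{0<..}. principal {(x, y). dist x y < e})"

definition open_circle :: "circle set \<Rightarrow> bool" where
  "open_circle U \<longleftrightarrow> (\<forall>x\<in>U. eventually (\<lambda>(x', y). x' = x \<longrightarrow> y \<in> U) uniformity)"

instance
proof
  fix x y z :: circle
  have R: "0 \<le> Rep_circle w \<and> Rep_circle w < 1" for w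
    using Rep_circle[of w] by simp
  show "dist x y = 0 \<longleftrightarrow> x = y"
    using R[of x] R[of y] Rep_circle_inject[of x y]
    by (auto simp: dist_circle_def min_def split: if_splits)
  show "dist x y \<le> dist x z + dist y z"
  proof -
    define a b c where "a = Rep_circle x" "b = Rep_circle y" "c = Rep_circle z"
    have r: "0 \<le> a" "a < 1" "0 \<le> b" "b < 1" "0 \<le> c" "c < 1"
      using R by (auto simp: a_b_c_def)
    have 1: "\<bar>a - b\<bar> \<le> \<bar>a - c\<bar> + \<bar>b - c\<bar>" by arith
    have 2: "1 - \<bar>a - b\<bar> \<le> \<bar>a - c\<bar> + (1 - \<bar>b - c\<bar>)" by arith
    have 3: "1 - \<bar>a - b\<bar> \<le> (1 - \<bar>a - c\<bar>) + \<bar>b - c\<bar>" by arith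
    have 4: "\<bar>a - b\<bar> \<le> (1 - \<bar>a - c\<bar>) + (1 - \<bar>b - c\<bar>)"
      using r by (cases "a \<le> b"; cases "a \<le> c"; cases "b \<le> c"; simp)
    from 1 2 3 4 show ?thesis
      unfolding dist_circle_def a_b_c_def[symmetric] min_def by simp
  qed
qed (simp_all add: uniformity_circle_def open_circle_def)

end

text \<open>The covering map from the line to the circle.\<close>

definition circ :: "real \<Rightarrow> circle" where
  "circ t = Abs_circle (frac t)"

definition doubling :: "circle \<Rightarrow> circle" where
  "doubling x = circ (2 * Rep_circle x)"

text \<open>The family \<open>\<K>\<^sub>D\<close>.\<close>

definition doubling_invariant_compacts :: "circle set set" where
  "doubling_invariant_compacts = {K. K \<noteq> {} \<and> compact K \<and> doubling ` K \<subseteq> K}"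


section \<open>Hausdorff dimension\<close>

text \<open>With the convention \<open>0\<^sup>0 = 1\<close> for nonempty sets, unlike \<open>0 powr 0 = 0\<close>.\<close>

definition diam_power :: "real \<Rightarrow> 'a::metric_space set \<Rightarrow> real" where
  "diam_power s U = (if U = {} then 0 else if s = 0 then 1 else diameter U powr s)"

definition hausdorff_premeasure :: "real \<Rightarrow> real \<Rightarrow> 'a::metric_space set \<Rightarrow> ennreal" where
  "hausdorff_premeasure s \<delta> A =
     (INF U \<in> {U :: nat \<Rightarrow> 'a set. A \<subseteq> (\<Union>i. U i) \<and> (\<forall>i. bounded (U i) \<and> diameter (U i) \<le> \<delta>)}.
        \<Sum>i. ennreal (diam_power s (U i)))"

definition hausdorff_measure :: "real \<Rightarrow> 'a::metric_space set \<Rightarrow> ennreal" where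
  "hausdorff_measure s A = (SUP \<delta>\<in>{0<..}. hausdorff_premeasure s \<delta> A)"

definition hausdorff_dim :: "'a::metric_space set \<Rightarrow> ereal" where
  "hausdorff_dim A = (INF s \<in> {s. 0 \<le> s \<and> hausdorff_measure s A = 0}. ereal s)"


section \<open>Functions of class \<open>C\<^sup>\<alpha>\<close> and the \<open>C\<^sup>\<alpha>\<close> norm\<close>

text \<open>
  For finite \<open>\<alpha>\<close> write \<open>\<alpha> = r + \<beta>\<close> with \<open>r\<close> a natural number and \<open>0 \<le> \<beta> < 1\<close>. For \<open>\<beta> = 0\<close> class
  \<open>C\<^sup>\<alpha>\<close> is class \<open>C\<^sup>r\<close>; for \<open>\<beta> > 0\<close> the \<open>r\<close>-th derivative is moreover \<open>\<beta>\<close>-Hoelder on compact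
  intervals. The set \<open>S\<close> below is always open.
\<close>

definition Ck_on :: "nat \<Rightarrow> real set \<Rightarrow> (real \<Rightarrow> real) \<Rightarrow> bool" where
  "Ck_on r S F \<longleftrightarrow>
     (\<forall>k<r. (deriv ^^ k) F differentiable_on S) \<and> continuous_on S ((deriv ^^ r) F)"

definition locally_Hoelder_on :: "real \<Rightarrow> real set \<Rightarrow> (real \<Rightarrow> real) \<Rightarrow> bool" where
  "locally_Hoelder_on \<beta> S h \<longleftrightarrow>
     (\<forall>a b. {a..b} \<subseteq> S \<longrightarrow>
       (\<exists>C. \<forall>x\<in>{a..b}. \<forall>y\<in>{a..b}. \<bar>h x - h y\<bar> \<le> C * \<bar>x - y\<bar> powr \<beta>))"

definition int_order :: "ereal \<Rightarrow> nat" where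
  "int_order \<alpha> = nat \<lfloor>real_of_ereal \<alpha>\<rfloor>"

definition frac_order :: "ereal \<Rightarrow> real" where
  "frac_order \<alpha> = frac (real_of_ereal \<alpha>)"

definition Calpha_on :: "ereal \<Rightarrow> real set \<Rightarrow> (real \<Rightarrow> real) \<Rightarrow> bool" where
  "Calpha_on \<alpha> S F \<longleftrightarrow>
     (if \<alpha> = \<infinity> then \<forall>r. Ck_on r S F
      else Ck_on (int_order \<alpha>) S F \<and>
        (frac_order \<alpha> \<noteq> 0 \<longrightarrow>
           locally_Hoelder_on (frac_order \<alpha>) S ((deriv ^^ int_order \<alpha>) F)))"

text \<open>
  The norms are applied to functions that may fail to be \<open>C\<^sup>r\<close> at finitely many points per period.
  Those points are left out of the suprema, and in the Hoelder seminorm only pairs that they do not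
  separate are compared. The norms take the value \<open>\<infinity>\<close> where a derivative is unbounded.
\<close>

definition Ck_points :: "nat \<Rightarrow> (real \<Rightarrow> real) \<Rightarrow> real set" where
  "Ck_points r \<phi> = {t. \<exists>S. open S \<and> t \<in> S \<and> Ck_on r S \<phi>}"

definition Ck_norm :: "nat \<Rightarrow> (real \<Rightarrow> real) \<Rightarrow> ennreal" where
  "Ck_norm r \<phi> = (\<Sum>k\<le>r. SUP t\<in>Ck_points r \<phi>. ennreal \<bar>(deriv ^^ k) \<phi> t\<bar>)"

definition Hoelder_seminorm :: "nat \<Rightarrow> real \<Rightarrow> (real \<Rightarrow> real) \<Rightarrow> ennreal" where
  "Hoelder_seminorm r \<beta> \<phi> =
     (SUP (x, y) \<in> {(x, y). x < y \<and> {x..y} \<subseteq> Ck_points r \<phi>}.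
        ennreal (\<bar>(deriv ^^ r) \<phi> x - (deriv ^^ r) \<phi> y\<bar> / \<bar>x - y\<bar> powr \<beta>))"

text \<open>For \<open>\<alpha> = \<infinity>\<close> this is the usual metric combination of all the \<open>C\<^sup>n\<close> norms.\<close>

definition Calpha_norm :: "ereal \<Rightarrow> (real \<Rightarrow> real) \<Rightarrow> ennreal" where
  "Calpha_norm \<alpha> \<phi> =
     (if \<alpha> = \<infinity> then \<Sum>n. ennreal ((1/2) ^ n) * min 1 (Ck_norm n \<phi>)
      else Ck_norm (int_order \<alpha>) \<phi> +
        (if frac_order \<alpha> = 0 then 0
         else Hoelder_seminorm (int_order \<alpha>) (frac_order \<alpha>) \<phi>))"


section \<open>Expanding Markov maps\<close>

definition is_lift :: "(circle \<Rightarrow> circle) \<Rightarrow> (real \<Rightarrow> real) \<Rightarrow> bool" where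
  "is_lift f F \<longleftrightarrow> continuous_on UNIV F \<and> (\<forall>t. circ (F t) = f (circ t))"

definition local_homeomorphism :: "('a::topological_space \<Rightarrow> 'b::topological_space) \<Rightarrow> bool" where
  "local_homeomorphism f \<longleftrightarrow>
     (\<forall>x. \<exists>U V g. open U \<and> x \<in> U \<and> open V \<and> homeomorphism U V f g)"

text \<open>
  The cyclically ordered points are the \<open>circ (t i)\<close>, and the fundamental intervals are the arcs
  \<open>circ ` {t i..<t (Suc i)}\<close>. Regularity and derivatives of \<open>f\<close> are those of a lift (two lifts
  differ by an integer constant). The map need not be differentiable at the points \<open>circ (t i)\<close>.
\<close>

definition expanding_Markov :: "ereal \<Rightarrow> (circle \<Rightarrow> circle) \<Rightarrow> bool" where
  "expanding_Markov \<alpha> f \<longleftrightarrow>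
     local_homeomorphism f \<and>
     (\<exists>F n t \<gamma>. is_lift f F \<and> 0 < n \<and> (\<forall>i<n. t i < t (Suc i)) \<and> t n = t 0 + 1 \<and> 1 < \<gamma> \<and>
        (\<forall>i<n. bij_betw f (circ ` {t i..<t (Suc i)}) UNIV \<and>
               Calpha_on \<alpha> {t i<..<t (Suc i)} F \<and>
               (\<forall>s\<in>{t i<..<t (Suc i)}. \<gamma> < \<bar>deriv F s\<bar>)))"

text \<open>
  The norm of \<open>f - g\<close>, computed on lifts. The infimum only selects the integer constant by which
  \<open>F - G\<close> can be changed; maps of different degree are at distance \<open>\<infinity>\<close> when \<open>\<alpha> < \<infinity>\<close>.
\<close>

definition Calpha_dist :: "ereal \<Rightarrow> (circle \<Rightarrow> circle) \<Rightarrow> (circle \<Rightarrow> circle) \<Rightarrow> ennreal" where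
  "Calpha_dist \<alpha> f g =
     (INF (F, G) \<in> {(F, G). is_lift f F \<and> is_lift g G}. Calpha_norm \<alpha> (\<lambda>t. F t - G t))"

text \<open>The space \<open>\<E>\<^sup>\<alpha>\<close> with the topology of the \<open>C\<^sup>\<alpha>\<close> norm.\<close>

definition expanding_Markov_open :: "ereal \<Rightarrow> (circle \<Rightarrow> circle) set \<Rightarrow> bool" where
  "expanding_Markov_open \<alpha> U \<longleftrightarrow>
     U \<subseteq> Collect (expanding_Markov \<alpha>) \<and>
     (\<forall>f\<in>U. \<exists>\<epsilon>>0. \<forall>g. expanding_Markov \<alpha> g \<and> Calpha_dist \<alpha> f g < \<epsilon> \<longrightarrow> g \<in> U)"

definition expanding_Markov_space :: "ereal \<Rightarrow> (circle \<Rightarrow> circle) topology" where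
  "expanding_Markov_space \<alpha> = topology (expanding_Markov_open \<alpha>)"

lemma istopology_balls:
  fixes d :: "'a \<Rightarrow> 'a \<Rightarrow> ennreal"
  shows "istopology (\<lambda>U. U \<subseteq> M \<and> (\<forall>f\<in>U. \<exists>\<epsilon>>0. \<forall>g. g \<in> M \<and> d f g < \<epsilon> \<longrightarrow> g \<in> U))"
    (is "istopology (\<lambda>U. U \<subseteq> M \<and> (\<forall>f\<in>U. ?N f U))")
proof -
  have inter: "?N f (U \<inter> V)" if "?N f U" "?N f V" for f U V
  proof -
    from that(1) obtain a where a: "0 < a" "\<And>g. g \<in> M \<and> d f g < a \<Longrightarrow> g \<in> U" by auto
    from that(2) obtain b where b: "0 < b" "\<And>g. g \<in> M \<and> d f g < b \<Longrightarrow> g \<in> V" by auto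
    show ?thesis
      by (rule exI[of _ "min a b"]) (simp add: a b)
  qed
  have mono: "?N f V" if "?N f U" "U \<subseteq> V" for f U V
  proof -
    from that(1) obtain a where a: "0 < a" "\<And>g. g \<in> M \<and> d f g < a \<Longrightarrow> g \<in> U" by auto
    show ?thesis
      by (rule exI[of _ a]) (use a that(2) in auto)
  qed
  show ?thesis
    unfolding istopology_def
  proof (intro conjI allI impI ballI)
    fix U V f assume "U \<subseteq> M \<and> (\<forall>f\<in>U. ?N f U)" "V \<subseteq> M \<and> (\<forall>f\<in>V. ?N f V)" "f \<in> U \<inter> V"
    then show "?N f (U \<inter> V)" by (intro inter) simp_all
  next
    fix \<U> f assume A: "\<forall>U\<in>\<U>. U \<subseteq> M \<and> (\<forall>f\<in>U. ?N f U)" and "f \<in> \<Union>\<U>"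
    then obtain U where U: "U \<in> \<U>" "f \<in> U" by (elim UnionE)
    show "?N f (\<Union>\<U>)"
      by (rule mono[of f U]) (use A U in simp, rule Union_upper[OF U(1)])
  qed (simp_all add: Union_least le_infI1)
qed

lemma openin_expanding_Markov_space:
  "openin (expanding_Markov_space \<alpha>) U \<longleftrightarrow> expanding_Markov_open \<alpha> U"
proof -
  have "istopology (expanding_Markov_open \<alpha>)"
    using istopology_balls[of "Collect (expanding_Markov \<alpha>)" "Calpha_dist \<alpha>"]
    unfolding expanding_Markov_open_def[abs_def] mem_Collect_eq .
  then show ?thesis
    unfolding expanding_Markov_space_def by (simp only: topology_inverse')
qed

lemma topspace_expanding_Markov_space:
  "topspace (expanding_Markov_space \<alpha>) = Collect (expanding_Markov \<alpha>)"
proof (rule antisym)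
  show "topspace (expanding_Markov_space \<alpha>) \<subseteq> Collect (expanding_Markov \<alpha>)"
    using openin_topspace[of "expanding_Markov_space \<alpha>"]
    unfolding openin_expanding_Markov_space expanding_Markov_open_def by (rule conjunct1)
  have "expanding_Markov_open \<alpha> (Collect (expanding_Markov \<alpha>))"
    unfolding expanding_Markov_open_def by (intro conjI ballI exI[of _ 1]) simp_all
  then show "Collect (expanding_Markov \<alpha>) \<subseteq> topspace (expanding_Markov_space \<alpha>)"
    by (intro openin_subset) (simp only: openin_expanding_Markov_space)
qed


section \<open>Residual sets\<close>

definition residual_in :: "'a topology \<Rightarrow> 'a set \<Rightarrow> bool" where
  "residual_in X R \<longleftrightarrow>
     R \<subseteq> topspace X \<and>
     (\<exists>\<U>. countable \<U> \<and> (\<forall>U\<in>\<U>. openin X U \<and> X closure_of U = topspace X) \<and>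
          topspace X \<inter> \<Inter>\<U> \<subseteq> R)"

end

theory Submission
  imports Defs
begin

text \<open>
  Write \<open>N\<^sub>n(A)\<close> for the number of dyadic arcs of length \<open>2 ^ - n\<close> that meet \<open>A\<close>. For a compact
  set \<open>K\<close> invariant under doubling, Hausdorff dimension controls these numbers although in general
  it only bounds box dimension from below: below dimension \<open>1/2\<close>, Furstenberg's argument
  (\<open>dyadic_count_growth\<close>) gives \<open>N\<^sub>n(K) \<le> A * 2 powr (s * n)\<close> for some \<open>s < 1/2\<close>. So for some
  \<open>n\<close> the set \<open>W\<close> of binary words of length \<open>n\<close> that begin points of \<open>K\<close> satisfies
  \<open>(card W)\<^sup>2 < 2 ^ n\<close> (\<open>dyadic_count_below_sqrt\<close>).

  By invariance every block of \<open>n\<close> consecutive binary digits of a point of \<open>K\<close> lies in \<open>W\<close>, so \<open>K\<close>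
  lies in the closure \<open>Y\<close> of the set of all points with this property. There are uncountably many
  \<open>K\<close>, but only countably many pairs \<open>(n, W)\<close>. It therefore suffices that for each such \<open>Y\<close> the
  maps \<open>f\<close> with \<open>f ` Y \<inter> Y = {}\<close> form an open and dense set.

  Openness is compactness of \<open>Y\<close>, since the \<open>C\<^sup>\<alpha>\<close> distance dominates the uniform distance
  (\<open>expanding_Markov_open_disjoint\<close>). For density (\<open>dense_disjoint\<close>), \<open>f\<close> is followed by a small
  rotation, which changes no derivative. A rotation by \<open>t\<close> fails only if \<open>t\<close> lies in
  \<open>Y - f ` Y\<close> modulo \<open>1\<close>. Counting words in \<open>W\<close> shows that \<open>N\<^sub>m(Y)\<^sup>2 / 2 ^ m\<close> becomes arbitrarily
  small, and this makes the difference of \<open>Y\<close> and a Lipschitz image of \<open>Y\<close> a null set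
  (\<open>negligible_Lipschitz_differences\<close>). A map in the space need not be Lipschitz, because its
  derivative may blow up at the end points of the fundamental intervals, but it is locally Lipschitz
  off a countable set, and a countable union of null sets is null.
\<close>

section \<open>The circle as a quotient of the line\<close>

lemma Rep_circle_bounds: "0 \<le> Rep_circle x" "Rep_circle x < 1"
  using Rep_circle[of x] by simp_all

lemma Rep_circle_circ [simp]: "Rep_circle (circ t) = frac t"
  by (simp add: circ_def Abs_circle_inverse frac_ge_0 frac_lt_1)

lemma circ_Rep_circle [simp]: "circ (Rep_circle x) = x"
  by (metis Rep_circle_bounds Rep_circle_circ Rep_circle_inject frac_eq)

lemma circ_eq_iff: "circ a = circ b \<longleftrightarrow> a - b \<in> \<int>"
proof -
  have "circ a = circ b \<longleftrightarrow> frac a = frac b"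
    by (metis Rep_circle_circ Rep_circle_inject)
  also have "\<dots> \<longleftrightarrow> a - b \<in> \<int>"
  proof
    assume "frac a = frac b"
    then have "a - b = of_int (\<lfloor>a\<rfloor> - \<lfloor>b\<rfloor>)" by (simp add: frac_def)
    then show "a - b \<in> \<int>" by (metis Ints_of_int)
  next
    assume "a - b \<in> \<int>"
    then obtain k where "a - b = of_int k" by (elim Ints_cases)
    then have "a = b + of_int k" by simp
    then show "frac a = frac b" by (simp add: frac_def)
  qed
  finally show ?thesis .
qed

lemma circ_add_int [simp]: "circ (t + of_int k) = circ t"
  by (simp add: circ_eq_iff)

lemma dist_circ_le: "dist (circ a) (circ b) \<le> \<bar>a - b\<bar>"
proof (cases "\<lfloor>a\<rfloor> = \<lfloor>b\<rfloor>")
  case True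
  then have "frac a - frac b = a - b" by (simp add: frac_def)
  then show ?thesis by (simp add: dist_circle_def)
next
  case False
  define m where "m = \<lfloor>a\<rfloor> - \<lfloor>b\<rfloor>"
  have "1 \<le> \<bar>m\<bar>" using False by (simp add: m_def)
  then have "1 \<le> \<bar>real_of_int m\<bar>" by linarith
  moreover have "frac a - frac b = a - b - of_int m" by (simp add: frac_def m_def)
  ultimately have "1 - \<bar>frac a - frac b\<bar> \<le> \<bar>a - b\<bar>" by linarith
  then show ?thesis by (simp add: dist_circle_def)
qed

lemma dist_circle_attained:
  obtains a b where "x = circ a" "y = circ b" "dist x y = \<bar>a - b\<bar>"
proof -
  define p q where "p = Rep_circle x" and "q = Rep_circle y"
  have pq: "0 \<le> p" "p < 1" "0 \<le> q" "q < 1"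
    by (simp_all add: p_def q_def Rep_circle_bounds)
  have c: "x = circ p" "y = circ q" "x = circ (p - 1)" "x = circ (p + 1)"
    using circ_add_int[of p "-1"] circ_add_int[of p 1] by (simp_all add: p_def q_def)
  have d: "dist x y = min \<bar>p - q\<bar> (1 - \<bar>p - q\<bar>)"
    by (simp add: dist_circle_def p_def q_def)
  consider "\<bar>p - q\<bar> \<le> 1 - \<bar>p - q\<bar>" | "1 - \<bar>p - q\<bar> < \<bar>p - q\<bar>" "p < q"
    | "1 - \<bar>p - q\<bar> < \<bar>p - q\<bar>" "q \<le> p" by linarith
  then show ?thesis
  proof cases
    case 1 then show ?thesis using that[of p q] c d by simp
  next
    case 2 then show ?thesis using that[of "p + 1" q] c d pq by simp
  next
    case 3 then show ?thesis using that[of "p - 1" q] c d pq by simp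
  qed
qed

lemma continuous_on_circ [continuous_intros]: "continuous_on S circ"
proof (rule continuous_on_iff[THEN iffD2], intro ballI allI impI)
  fix a e :: real assume "0 < e"
  then show "\<exists>d>0. \<forall>b\<in>S. dist b a < d \<longrightarrow> dist (circ b) (circ a) < e"
    by (metis dist_circ_le dist_real_def le_less_trans)
qed

lemma compact_circle_UNIV: "compact (UNIV :: circle set)"
proof -
  have "(UNIV :: circle set) \<subseteq> circ ` {0..1}"
  proof
    fix x :: circle
    have "x = circ (Rep_circle x)" "Rep_circle x \<in> {0..1}"
      using Rep_circle_bounds[of x] by auto
    then show "x \<in> circ ` {0..1}" by (rule image_eqI)
  qed
  then have "(UNIV :: circle set) = circ ` {0..1}" by auto
  then show ?thesis
    using compact_continuous_image[OF continuous_on_circ compact_Icc, of 0 1] by metis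
qed

lemma compact_closure_circle: "compact (closure A)" for A :: "circle set"
  using compact_circle_UNIV closed_closure compact_Int_closed by fastforce

lemma Rep_doubling_iterate: "Rep_circle ((doubling ^^ m) x) = frac (2 ^ m * Rep_circle x)"
proof (induction m)
  case 0
  then show ?case using Rep_circle_bounds[of x] by (simp add: frac_eq)
next
  case (Suc m)
  let ?t = "2 ^ m * Rep_circle x"
  have "2 * frac ?t - 2 * ?t = of_int (- 2 * \<lfloor>?t\<rfloor>)" by (simp add: frac_def algebra_simps)
  then have "2 * frac ?t - 2 * ?t \<in> \<int>" by (metis Ints_of_int)
  then have "circ (2 * frac ?t) = circ (2 * ?t)" by (simp only: circ_eq_iff)
  then have eq: "frac (2 * frac ?t) = frac (2 * ?t)" by (metis Rep_circle_circ)
  have "Rep_circle ((doubling ^^ Suc m) x) = frac (2 * Rep_circle ((doubling ^^ m) x))"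
    by (simp add: doubling_def)
  then show ?case by (simp only: Suc eq power_Suc mult.assoc)
qed

section \<open>Dyadic arcs\<close>

text \<open>The arcs of generation \<open>n\<close> are half open, so that every point has exactly one index.\<close>

definition dyadic_index :: "nat \<Rightarrow> circle \<Rightarrow> int" where
  "dyadic_index n x = \<lfloor>2 ^ n * Rep_circle x\<rfloor>"

definition dyadic_count :: "nat \<Rightarrow> circle set \<Rightarrow> nat" where
  "dyadic_count n A = card (dyadic_index n ` A)"

lemma dyadic_index_range: "dyadic_index n x \<in> {0..<2 ^ n}"
proof -
  have "2 ^ n * Rep_circle x < 2 ^ n" using Rep_circle_bounds[of x] by simp
  then have "\<lfloor>2 ^ n * Rep_circle x\<rfloor> < 2 ^ n" by (simp add: floor_less_iff)
  then show ?thesis using Rep_circle_bounds[of x] by (simp add: dyadic_index_def)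
qed

lemma finite_dyadic_indices: "finite (dyadic_index n ` A)"
  by (rule finite_subset[of _ "{0..<2 ^ n}"]) (use dyadic_index_range in blast, simp)

lemma dyadic_count_le_power: "dyadic_count n A \<le> 2 ^ n"
proof -
  have "dyadic_count n A \<le> card {0..<2 ^ n :: int}"
    unfolding dyadic_count_def by (rule card_mono) (use dyadic_index_range in blast)+
  then show ?thesis by (simp add: nat_power_eq)
qed

text \<open>In binary digits: the first \<open>m + n\<close> digits of \<open>x\<close> are the first \<open>m\<close> digits of \<open>x\<close>
  followed by the first \<open>n\<close> digits of its \<open>m\<close>-th image under doubling.\<close>

lemma dyadic_index_add:
  "dyadic_index (m + n) x = 2 ^ n * dyadic_index m x + dyadic_index n ((doubling ^^ m) x)"
proof -
  let ?t = "2 ^ m * Rep_circle x"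
  have "2 ^ (m + n) * Rep_circle x = 2 ^ n * frac ?t + of_int (2 ^ n * \<lfloor>?t\<rfloor>)"
    by (simp add: frac_def power_add algebra_simps)
  then have "\<lfloor>2 ^ (m + n) * Rep_circle x\<rfloor> = \<lfloor>2 ^ n * frac ?t\<rfloor> + 2 ^ n * \<lfloor>?t\<rfloor>"
    by (metis floor_add_int)
  then show ?thesis by (simp add: dyadic_index_def Rep_doubling_iterate)
qed

text \<open>The indices \<open>0\<close> and \<open>2 ^ n - 1\<close> account for pairs of close points on the two sides of the
  base point of the circle.\<close>

definition dyadic_neighbours :: "nat \<Rightarrow> int \<Rightarrow> int set" where
  "dyadic_neighbours n k = {k - 1, k, k + 1, 0, 2 ^ n - 1}"

lemma finite_dyadic_neighbours [simp]: "finite (dyadic_neighbours n k)"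
  by (simp add: dyadic_neighbours_def)

lemma card_dyadic_neighbours: "card (dyadic_neighbours n k) \<le> 5"
proof -
  have "card (set [k - 1, k, k + 1, 0, 2 ^ n - 1]) \<le> length [k - 1, k, k + 1, 0, 2 ^ n - 1]"
    by (rule card_length)
  then show ?thesis by (simp add: dyadic_neighbours_def)
qed

lemma dyadic_index_close:
  assumes "dist x y < 1 / 2 ^ n"
  shows "dyadic_index n y \<in> dyadic_neighbours n (dyadic_index n x)"
proof -
  define p q :: real where "p = Rep_circle x" and "q = Rep_circle y"
  have pq: "0 \<le> p" "p < 1" "0 \<le> q" "q < 1"
    by (simp_all add: p_def q_def Rep_circle_bounds)
  have d: "min \<bar>p - q\<bar> (1 - \<bar>p - q\<bar>) < 1 / 2 ^ n"
    using assms by (simp add: dist_circle_def p_def q_def)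
  have N: "0 < (2 ^ n :: real)" by simp
  consider "\<bar>p - q\<bar> < 1 / 2 ^ n" | "1 - (q - p) < 1 / 2 ^ n" | "1 - (p - q) < 1 / 2 ^ n"
    using d by linarith
  then show ?thesis
  proof cases
    case 1
    have "\<bar>2 ^ n * p - 2 ^ n * q\<bar> = 2 ^ n * \<bar>p - q\<bar>"
      by (simp add: abs_mult flip: right_diff_distrib)
    also have "\<dots> < 1" using 1 by (simp add: field_simps)
    finally have "\<bar>2 ^ n * p - 2 ^ n * q\<bar> < 1" .
    then have "\<lfloor>2 ^ n * q\<rfloor> \<in> {\<lfloor>2 ^ n * p\<rfloor> - 1, \<lfloor>2 ^ n * p\<rfloor>, \<lfloor>2 ^ n * p\<rfloor> + 1}"
      unfolding insert_iff by linarith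
    then show ?thesis
      unfolding dyadic_neighbours_def dyadic_index_def p_def q_def by blast
  next
    case 2
    then have "1 - 1 / 2 ^ n < q" using pq by linarith
    then have "2 ^ n - 1 < 2 ^ n * q" by (simp add: field_simps)
    moreover have "2 ^ n * q < 2 ^ n" using pq by simp
    ultimately have "\<lfloor>2 ^ n * q\<rfloor> = 2 ^ n - 1" by (intro floor_unique) simp_all
    then show ?thesis
      unfolding dyadic_neighbours_def dyadic_index_def p_def q_def by blast
  next
    case 3
    then have "q < 1 / 2 ^ n" using pq by linarith
    then have "2 ^ n * q < 1" by (simp add: field_simps)
    then have "\<lfloor>2 ^ n * q\<rfloor> = 0" using pq by (intro floor_unique) simp_all
    then show ?thesis
      unfolding dyadic_neighbours_def dyadic_index_def p_def q_def by blast
  qed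
qed

text \<open>The closure matters because sets described by half-open arcs need not be closed.\<close>

lemma dyadic_count_closure: "dyadic_count n (closure A) \<le> 5 * dyadic_count n A"
proof -
  have "dyadic_index n ` closure A \<subseteq> (\<Union>k\<in>dyadic_index n ` A. dyadic_neighbours n k)"
  proof (rule image_subsetI)
    fix y assume "y \<in> closure A"
    then obtain x where "x \<in> A" "dist x y < 1 / 2 ^ n"
      unfolding closure_approachable by (meson zero_less_divide_1_iff zero_less_numeral zero_less_power)
    then show "dyadic_index n y \<in> (\<Union>k\<in>dyadic_index n ` A. dyadic_neighbours n k)"
      using dyadic_index_close by blast
  qed
  then have "dyadic_count n (closure A) \<le> card (\<Union>k\<in>dyadic_index n ` A. dyadic_neighbours n k)"
    unfolding dyadic_count_def by (intro card_mono finite_UN_I finite_dyadic_indices) simp_all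
  also have "\<dots> \<le> (\<Sum>k\<in>dyadic_index n ` A. card (dyadic_neighbours n k))"
    by (intro card_UN_le finite_dyadic_indices)
  also have "\<dots> \<le> (\<Sum>k\<in>dyadic_index n ` A. 5)"
    by (intro sum_mono card_dyadic_neighbours)
  finally show ?thesis by (simp add: dyadic_count_def)
qed

lemma doubling_iterate_invariant:
  assumes "doubling ` A \<subseteq> A" "x \<in> A"
  shows "(doubling ^^ m) x \<in> A"
  by (induction m) (use assms in auto)

lemma dyadic_count_add:
  assumes "doubling ` A \<subseteq> A"
  shows "dyadic_count (m + n) A \<le> dyadic_count m A * dyadic_count n A"
proof -
  let ?g = "\<lambda>(k, j). 2 ^ n * k + j :: int"
  let ?P = "dyadic_index m ` A \<times> dyadic_index n ` A"
  have "dyadic_index (m + n) ` A \<subseteq> ?g ` ?P"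
  proof (rule image_subsetI)
    fix x assume x: "x \<in> A"
    then have "(dyadic_index m x, dyadic_index n ((doubling ^^ m) x)) \<in> ?P"
      using doubling_iterate_invariant[OF assms] by simp
    then show "dyadic_index (m + n) x \<in> ?g ` ?P"
      by (rule rev_image_eqI) (simp add: dyadic_index_add)
  qed
  then have "dyadic_count (m + n) A \<le> card ?P"
    unfolding dyadic_count_def by (rule surj_card_le[rotated]) (simp add: finite_dyadic_indices)
  then show ?thesis by (simp add: dyadic_count_def card_cartesian_product)
qed

lemma dyadic_count_mult:
  assumes "doubling ` A \<subseteq> A"
  shows "dyadic_count (n * j) A \<le> dyadic_count n A ^ j"
proof (induction j)
  case 0
  then show ?case using dyadic_count_le_power[of 0 A] by simp
next
  case (Suc j)
  have "dyadic_count (n * Suc j) A \<le> dyadic_count n A * dyadic_count (n * j) A"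
    using dyadic_count_add[OF assms, of n "n * j"] by simp
  also have "\<dots> \<le> dyadic_count n A * dyadic_count n A ^ j"
    using Suc by simp
  finally show ?case by simp
qed

section \<open>Invariant sets of small Hausdorff dimension\<close>

text \<open>Sets of zero Hausdorff measure have covers by sets of small total weight. Enlarging the
  covering sets to balls makes the cover open, so that a compact set needs finitely many of them;
  the enlargement also gives a positive radius to covering sets of diameter zero.\<close>

lemma hausdorff_null_compact_ball_cover:
  fixes A :: "'a::metric_space set"
  assumes "hausdorff_measure s A = 0" "0 < s" "compact A" "0 < \<epsilon>"
  obtains I :: "nat set" and u :: "nat \<Rightarrow> 'a" and \<rho> :: "nat \<Rightarrow> real"
  where "finite I" "\<And>i. 0 < \<rho> i" "A \<subseteq> (\<Union>i\<in>I. ball (u i) (\<rho> i))" "(\<Sum>i\<in>I. \<rho> i powr s) < \<epsilon>"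
proof -
  have "hausdorff_premeasure s 1 A \<le> hausdorff_measure s A"
    unfolding hausdorff_measure_def by (rule SUP_upper) simp
  then have "hausdorff_premeasure s 1 A < ennreal (\<epsilon> / 2)" using assms by simp
  then obtain U :: "nat \<Rightarrow> 'a set" where cover: "A \<subseteq> (\<Union>i. U i)"
    and bounded: "\<And>i. bounded (U i)"
    and small: "(\<Sum>i. ennreal (diam_power s (U i))) < ennreal (\<epsilon> / 2)"
    unfolding hausdorff_premeasure_def INF_less_iff by blast
  define d where "d i = diameter (U i) powr s" for i
  \<comment> \<open>The summable excess \<open>e i\<close> makes each radius strictly larger than the diameter.\<close>
  define e where "e i = \<epsilon> / 2 * (1 / 2) ^ Suc i" for i :: nat
  define \<rho> where "\<rho> i = (d i + e i) powr (1 / s)" for i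
  define u where "u i = (SOME x. x \<in> U i)" for i
  have d_eq: "diam_power s (U i) = d i" for i
    using assms by (simp add: diam_power_def d_def diameter_def)
  have pos: "0 \<le> d i" "0 < e i" for i using assms by (simp_all add: d_def e_def)
  have rho_powr: "\<rho> i powr s = d i + e i" for i
    using pos[of i] assms by (simp add: \<rho>_def powr_powr)
  have rho_pos: "0 < \<rho> i" for i using pos[of i] by (simp add: \<rho>_def)
  have diam_less: "diameter (U i) < \<rho> i" for i
  proof -
    have "0 \<le> diameter (U i)" by (rule diameter_ge_0[OF bounded])
    then have "diameter (U i) = d i powr (1 / s)" using assms by (simp add: d_def powr_powr)
    also have "\<dots> < \<rho> i"
      unfolding \<rho>_def by (rule powr_less_mono2) (use assms pos[of i] in auto)
    finally show ?thesis .
  qed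
  have ball: "U i \<subseteq> ball (u i) (\<rho> i)" for i
  proof
    fix x assume x: "x \<in> U i"
    then have "u i \<in> U i" unfolding u_def by (rule someI)
    then have "dist (u i) x \<le> diameter (U i)" using x bounded by (intro diameter_bounded_bound)
    then show "x \<in> ball (u i) (\<rho> i)" using diam_less[of i] by simp
  qed
  have "A \<subseteq> (\<Union>i\<in>UNIV. ball (u i) (\<rho> i))"
    using cover ball by blast
  then obtain I where I: "finite I" "A \<subseteq> (\<Union>i\<in>I. ball (u i) (\<rho> i))"
    using compactE_image[OF \<open>compact A\<close>, of UNIV "\<lambda>i. ball (u i) (\<rho> i)"] by auto
  have "ennreal (\<Sum>i\<in>I. d i) = (\<Sum>i\<in>I. ennreal (diam_power s (U i)))"
    using pos by (simp add: d_eq)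
  also have "\<dots> \<le> (\<Sum>i. ennreal (diam_power s (U i)))"
    by (rule sum_le_suminf) (simp_all add: I)
  also note small
  finally have sum_d: "(\<Sum>i\<in>I. d i) < \<epsilon> / 2"
    using pos by (subst (asm) ennreal_less_iff) (simp_all add: sum_nonneg)
  have sums_e: "e sums (\<epsilon> / 2)"
    using sums_mult[OF power_half_series, of "\<epsilon> / 2"]
    unfolding e_def[abs_def] mult_1_right .
  have sum_e: "(\<Sum>i\<in>I. e i) \<le> \<epsilon> / 2"
    using sum_le_suminf[OF sums_summable[OF sums_e] I(1)] pos(2) sums_unique[OF sums_e]
    by (simp add: less_imp_le)
  have "(\<Sum>i\<in>I. \<rho> i powr s) < \<epsilon>"
    using sum_d sum_e by (simp add: rho_powr sum.distrib)
  with I rho_pos show thesis by (intro that)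
qed

text \<open>Furstenberg's argument. If every point of an invariant set begins with one of finitely many
  words of total weight at most \<open>1\<close>, then after such a word one finds another point of the set.
  Counting by the first word, the number of words of length \<open>n\<close> obeys a linear recursion whose
  characteristic root is at most \<open>2 powr s\<close>.\<close>

lemma dyadic_count_growth:
  fixes m :: "'i \<Rightarrow> nat" and k :: "'i \<Rightarrow> int" and s :: real
  assumes inv: "doubling ` K \<subseteq> K" and "finite J" and m_pos: "\<And>j. j \<in> J \<Longrightarrow> 0 < m j"
    and cover: "\<And>x. x \<in> K \<Longrightarrow> \<exists>j\<in>J. dyadic_index (m j) x = k j"
    and weight: "(\<Sum>j\<in>J. 2 powr (- s * m j)) \<le> 1" and "0 \<le> s"
  obtains A where "\<And>n. dyadic_count n K \<le> A * 2 powr (s * n)"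
proof -
  define L where "L = sum m J"
  have m_le: "m j \<le> L" if "j \<in> J" for j
    unfolding L_def using that \<open>finite J\<close> by (intro member_le_sum) simp_all
  have "dyadic_count n K \<le> 2 ^ L * 2 powr (s * n)" for n
  proof (induction n rule: less_induct)
    case (less n)
    show ?case
    proof (cases "n \<le> L")
      \<comment> \<open>The recursion needs \<open>n\<close> to exceed every word length; below \<open>L\<close> the trivial bound
        \<open>2 ^ n\<close> is absorbed by the factor \<open>2 ^ L\<close>.\<close>
      case True
      have "real (dyadic_count n K) \<le> 2 ^ n"
        using dyadic_count_le_power[of n K] by (metis of_nat_le_numeral_power_cancel_iff)
      also have "\<dots> \<le> 2 ^ L * 1" using True by (simp add: power_increasing)
      also have "\<dots> \<le> 2 ^ L * 2 powr (s * n)"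
        using \<open>0 \<le> s\<close> by (intro mult_left_mono) (simp_all add: ge_one_powr_ge_zero)
      finally show ?thesis .
    next
      case False
      let ?R = "\<lambda>j. (\<lambda>i. 2 ^ (n - m j) * k j + i) ` dyadic_index (n - m j) ` K"
      have "dyadic_index n ` K \<subseteq> (\<Union>j\<in>J. ?R j)"
      proof (rule image_subsetI)
        fix x assume x: "x \<in> K"
        then obtain j where j: "j \<in> J" "dyadic_index (m j) x = k j" using cover by blast
        have "n = m j + (n - m j)" using m_le[OF j(1)] False by simp
        then have "dyadic_index n x
            = 2 ^ (n - m j) * k j + dyadic_index (n - m j) ((doubling ^^ m j) x)"
          using dyadic_index_add[of "m j" "n - m j" x] j(2) by simp
        then show "dyadic_index n x \<in> (\<Union>j\<in>J. ?R j)"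
          using j(1) doubling_iterate_invariant[OF inv x] by blast
      qed
      then have "dyadic_count n K \<le> card (\<Union>j\<in>J. ?R j)"
        unfolding dyadic_count_def
        by (intro card_mono finite_UN_I \<open>finite J\<close> finite_imageI[OF finite_dyadic_indices])
      also have "\<dots> \<le> (\<Sum>j\<in>J. card (?R j))" by (rule card_UN_le[OF \<open>finite J\<close>])
      also have "\<dots> \<le> (\<Sum>j\<in>J. dyadic_count (n - m j) K)"
        unfolding dyadic_count_def by (intro sum_mono card_image_le finite_dyadic_indices)
      finally have "real (dyadic_count n K) \<le> (\<Sum>j\<in>J. real (dyadic_count (n - m j) K))"
        by (metis of_nat_le_iff of_nat_sum)
      also have "\<dots> \<le> (\<Sum>j\<in>J. 2 ^ L * 2 powr (s * n) * 2 powr (- s * m j))"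
      proof (rule sum_mono)
        fix j assume j: "j \<in> J"
        have "real (dyadic_count (n - m j) K) \<le> 2 ^ L * 2 powr (s * (n - m j))"
          using m_pos[OF j] False by (intro less) simp
        also have "s * (n - m j) = s * n + - s * m j"
          using m_le[OF j] False by (simp add: algebra_simps of_nat_diff)
        finally show "real (dyadic_count (n - m j) K)
            \<le> 2 ^ L * 2 powr (s * n) * 2 powr (- s * m j)"
          by (simp only: powr_add mult.assoc)
      qed
      also have "\<dots> = 2 ^ L * 2 powr (s * n) * (\<Sum>j\<in>J. 2 powr (- s * m j))"
        by (simp only: sum_distrib_left)
      also have "\<dots> \<le> 2 ^ L * 2 powr (s * n) * 1"
        using weight by (intro mult_left_mono) simp_all
      finally show ?thesis by simp
    qed
  qed
  then show thesis by (rule that)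
qed

lemma dyadic_scale:
  fixes \<rho> :: real
  assumes "0 < \<rho>" "\<rho> \<le> 1"
  obtains m :: nat where "\<rho> \<le> 1 / 2 ^ m" "1 / 2 ^ m < 2 * \<rho>"
proof -
  obtain n0 where n0: "(1 / 2) ^ n0 < \<rho>"
    using real_arch_pow_inv[OF assms(1), of "1 / 2"] by auto
  define n where "n = (LEAST n. (1 / 2) ^ n < \<rho>)"
  have n: "(1 / 2) ^ n < \<rho>" unfolding n_def using n0 by (rule LeastI)
  then have "n \<noteq> 0" using assms by (cases n) auto
  then obtain m where m: "n = Suc m" by (cases n) auto
  then have "\<not> (1 / 2) ^ m < \<rho>" using not_less_Least[of m "\<lambda>n. (1 / 2) ^ n < \<rho>"]
    unfolding n_def by auto
  with n m show thesis by (intro that[of m]) (simp_all add: field_simps)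
qed

text \<open>Rounding the radii of a ball cover up to powers of \<open>1/2\<close> at most doubles the weight, and each
  ball then meets at most five arcs, so a ball cover of weight less than \<open>1 / 10\<close> yields words of
  total weight at most \<open>1\<close>.\<close>

lemma dyadic_count_growth_of_hausdorff_null:
  assumes inv: "doubling ` K \<subseteq> K" and "compact K"
    and s: "0 < s" "s \<le> 1" and null: "hausdorff_measure s K = 0"
  obtains A where "\<And>n. dyadic_count n K \<le> A * 2 powr (s * n)"
proof -
  have "(0 :: real) < 1 / 10" by simp
  then obtain I :: "nat set" and u :: "nat \<Rightarrow> circle" and \<rho> :: "nat \<Rightarrow> real"
    where "finite I" and rho_pos: "\<And>i. 0 < \<rho> i"
      and cover: "K \<subseteq> (\<Union>i\<in>I. ball (u i) (\<rho> i))" and sum: "(\<Sum>i\<in>I. \<rho> i powr s) < 1 / 10"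
    by (rule hausdorff_null_compact_ball_cover[OF null s(1) \<open>compact K\<close>]) (rule that)
  have double: "(2 * \<rho> i) powr s \<le> 2 * \<rho> i powr s" for i
  proof -
    have "(2 * \<rho> i) powr s = 2 powr s * \<rho> i powr s"
      using rho_pos[of i] by (simp add: powr_mult)
    also have "\<dots> \<le> 2 powr 1 * \<rho> i powr s"
      using s by (intro mult_right_mono powr_mono) simp_all
    finally show ?thesis by simp
  qed
  have rho_small: "2 * \<rho> i < 1" if "i \<in> I" for i
  proof (rule ccontr)
    assume "\<not> 2 * \<rho> i < 1"
    then have "1 \<le> (2 * \<rho> i) powr s" using s by (simp add: ge_one_powr_ge_zero)
    moreover have "\<rho> i powr s \<le> (\<Sum>i\<in>I. \<rho> i powr s)"
      using that \<open>finite I\<close> by (intro member_le_sum) simp_all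
    ultimately show False using double[of i] sum by linarith
  qed
  have "\<forall>i\<in>I. \<exists>m::nat. \<rho> i \<le> 1 / 2 ^ m \<and> 1 / 2 ^ m < 2 * \<rho> i"
  proof
    fix i assume "i \<in> I"
    then have "\<rho> i \<le> 1" using rho_small[of i] rho_pos[of i] by simp
    then show "\<exists>m::nat. \<rho> i \<le> 1 / 2 ^ m \<and> 1 / 2 ^ m < 2 * \<rho> i"
      using dyadic_scale[OF rho_pos[of i]] by blast
  qed
  then obtain m :: "nat \<Rightarrow> nat"
    where m: "\<And>i. i \<in> I \<Longrightarrow> \<rho> i \<le> 1 / 2 ^ m i" "\<And>i. i \<in> I \<Longrightarrow> 1 / 2 ^ m i < 2 * \<rho> i"
    by metis
  \<comment> \<open>A ball of radius at most \<open>2 ^ - m\<close> meets at most five arcs of generation \<open>m\<close>.\<close>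
  define N where "N i = dyadic_neighbours (m i) (dyadic_index (m i) (u i))" for i
  define J where "J = Sigma I N"
  have weight: "(\<Sum>j\<in>J. 2 powr (- s * m (fst j))) \<le> 1"
  proof -
    have "(\<Sum>j\<in>J. 2 powr (- s * m (fst j))) = (\<Sum>i\<in>I. \<Sum>k\<in>N i. 2 powr (- s * m i))"
      unfolding J_def using \<open>finite I\<close>
      by (subst sum.Sigma) (auto simp: N_def case_prod_unfold)
    also have "\<dots> \<le> (\<Sum>i\<in>I. 10 * \<rho> i powr s)"
    proof (rule sum_mono)
      fix i assume i: "i \<in> I"
      have "2 powr (- s * m i) = (1 / 2 ^ m i) powr s"
        by (simp add: powr_powr powr_realpow[symmetric] mult.commute divide_powr_uminus
              flip: powr_minus_divide)
      also have "\<dots> \<le> (2 * \<rho> i) powr s"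
        using m(2)[OF i] s by (intro powr_mono2) simp_all
      also note double[of i]
      finally have "2 powr (- s * m i) \<le> 2 * \<rho> i powr s" .
      moreover have "real (card (N i)) \<le> 5"
        using card_dyadic_neighbours[of "m i" "dyadic_index (m i) (u i)"] by (simp add: N_def)
      ultimately have "real (card (N i)) * 2 powr (- s * m i) \<le> 5 * (2 * \<rho> i powr s)"
        by (intro mult_mono) simp_all
      then show "(\<Sum>k\<in>N i. 2 powr (- s * m i)) \<le> 10 * \<rho> i powr s" by simp
    qed
    also have "\<dots> = 10 * (\<Sum>i\<in>I. \<rho> i powr s)" by (simp add: sum_distrib_left)
    finally show ?thesis using sum by simp
  qed
  have m_pos: "0 < m (fst j)" if "j \<in> J" for j
  proof (rule ccontr)
    assume "\<not> 0 < m (fst j)"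
    moreover have "fst j \<in> I" using that by (auto simp: J_def)
    ultimately show False using m(2)[of "fst j"] rho_small[of "fst j"] by simp
  qed
  have index: "\<exists>j\<in>J. dyadic_index (m (fst j)) x = snd j" if x: "x \<in> K" for x
  proof -
    obtain i where i: "i \<in> I" "dist (u i) x < \<rho> i" using cover x by auto
    then have "dist (u i) x < 1 / 2 ^ m i" using m(1)[OF i(1)] by linarith
    then have "dyadic_index (m i) x \<in> N i" unfolding N_def by (rule dyadic_index_close)
    then show ?thesis using i(1) by (intro bexI[of _ "(i, dyadic_index (m i) x)"]) (auto simp: J_def)
  qed
  have "finite J" using \<open>finite I\<close> by (simp add: J_def N_def)
  then obtain A where "\<And>n. dyadic_count n K \<le> A * 2 powr (s * n)"
    using dyadic_count_growth[OF inv _ m_pos index weight less_imp_le[OF s(1)]] by blast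
  then show thesis by (rule that)
qed

text \<open>At exponent \<open>0\<close> every nonempty covering set has weight \<open>1\<close>. So for a nonempty set, even of
  dimension zero, an exponent at which the measure vanishes is positive, as Furstenberg's argument
  requires.\<close>

lemma hausdorff_measure_0_eq_0_imp_empty:
  fixes A :: "'a::metric_space set"
  assumes "hausdorff_measure 0 A = 0"
  shows "A = {}"
proof (rule ccontr)
  assume "A \<noteq> {}"
  then obtain x where x: "x \<in> A" by blast
  have "hausdorff_premeasure 0 1 A \<le> hausdorff_measure 0 A"
    unfolding hausdorff_measure_def by (rule SUP_upper) simp
  then have "hausdorff_premeasure 0 1 A < 1" using assms by simp
  then obtain U :: "nat \<Rightarrow> 'a set" where cover: "A \<subseteq> (\<Union>i. U i)"
    and small: "(\<Sum>i. ennreal (diam_power 0 (U i))) < 1"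
    unfolding hausdorff_premeasure_def INF_less_iff by blast
  obtain i where "x \<in> U i" using cover x by blast
  then have "1 = (\<Sum>i\<in>{i}. ennreal (diam_power 0 (U i)))" by (auto simp: diam_power_def)
  also have "\<dots> \<le> (\<Sum>i. ennreal (diam_power 0 (U i)))" by (rule sum_le_suminf) simp_all
  finally show False using small by simp
qed

lemma dyadic_count_below_sqrt:
  assumes K: "K \<in> doubling_invariant_compacts" and dim: "hausdorff_dim K < 1 / 2"
  obtains n where "dyadic_count n K ^ 2 < 2 ^ n"
proof -
  have inv: "doubling ` K \<subseteq> K" and "compact K" and "K \<noteq> {}"
    using K by (simp_all add: doubling_invariant_compacts_def)
  obtain s where s: "0 \<le> s" "hausdorff_measure s K = 0" "ereal s < 1 / 2"
    using dim unfolding hausdorff_dim_def INF_less_iff by blast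
  have "(1 / 2 :: ereal) = ereal (1 / 2)" by (simp add: divide_ereal_def)
  then have s_half: "s < 1 / 2" using s(3) by (metis less_ereal.simps(1))
  have s_pos: "0 < s"
    using s \<open>K \<noteq> {}\<close> hausdorff_measure_0_eq_0_imp_empty by (cases "s = 0") auto
  obtain A where A: "\<And>n. dyadic_count n K \<le> A * 2 powr (s * n)"
    using dyadic_count_growth_of_hausdorff_null[OF inv \<open>compact K\<close> s_pos _ s(2)] s_half by auto
  have "1 < 2 powr (1 - 2 * s)" using s_half by simp
  then obtain n where n: "A\<^sup>2 < (2 powr (1 - 2 * s)) ^ n" using real_arch_pow by blast
  have "(real (dyadic_count n K))\<^sup>2 \<le> (A * 2 powr (s * n))\<^sup>2"
    by (intro power_mono A) simp
  also have "\<dots> = A\<^sup>2 * 2 powr (2 * s * n)"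
    by (simp add: power_mult_distrib power2_eq_square mult.assoc flip: powr_add)
  also have "\<dots> < (2 powr (1 - 2 * s)) ^ n * 2 powr (2 * s * n)"
    using n by (intro mult_strict_right_mono) simp_all
  also have "\<dots> = 2 powr ((1 - 2 * s) * n + 2 * s * n)"
    by (simp add: powr_add powr_power mult.commute)
  also have "(1 - 2 * s) * n + 2 * s * n = real n" by (simp add: algebra_simps)
  finally have "real (dyadic_count n K ^ 2) < real (2 ^ n)" by (simp add: powr_realpow)
  then show thesis unfolding of_nat_less_iff by (rule that)
qed

section \<open>Null difference sets\<close>

text \<open>The pairs \<open>(x, r)\<close> fall into \<open>N\<^sup>2\<close> classes, where \<open>N\<close> is the number of arcs of generation
  \<open>n\<close> that meet \<open>Y\<close>, and on each class \<open>x - h r\<close> varies by a constant times \<open>2 ^ - n\<close>. So the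
  difference set has outer measure at most a constant times \<open>N\<^sup>2 / 2 ^ n\<close>.\<close>

lemma negligible_Lipschitz_differences:
  fixes h :: "real \<Rightarrow> real"
  assumes small: "\<And>\<delta>. 0 < \<delta> \<Longrightarrow> \<exists>n. real (dyadic_count n Y) ^ 2 < \<delta> * 2 ^ n"
    and Lip: "\<And>r r'. r \<in> J \<Longrightarrow> r' \<in> J \<Longrightarrow> \<bar>h r - h r'\<bar> \<le> L * \<bar>r - r'\<bar>"
  shows "negligible {x - h r | x r. x \<in> Rep_circle ` Y \<and> r \<in> Rep_circle ` Y \<inter> J}" (is "negligible ?B")
proof (rule negligible_outer_le[THEN iffD2], intro allI impI)
  fix e :: real assume "0 < e"
  \<comment> \<open>Both coordinates contribute: \<open>x\<close> with constant \<open>1\<close> and \<open>h r\<close> with constant \<open>L\<close>.\<close>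
  define M where "M = 1 + \<bar>L\<bar>"
  have M: "0 < M" "L \<le> M - 1" by (simp_all add: M_def)
  have "0 < e / (2 * M)" using \<open>0 < e\<close> M by simp
  then obtain n where n: "real (dyadic_count n Y) ^ 2 < e / (2 * M) * 2 ^ n"
    using small by blast
  define I where "I = dyadic_index n ` Y"
  define T where "T i j = {x - h r | x r. r \<in> J \<and> \<lfloor>2 ^ n * x\<rfloor> = i \<and> \<lfloor>2 ^ n * r\<rfloor> = j}"
    for i j :: int
  have "\<exists>c. T i j \<subseteq> {c - M / 2 ^ n .. c + M / 2 ^ n}" for i j
  proof (cases "T i j = {}")
    case False
    then obtain x r :: real where xr: "r \<in> J" "\<lfloor>2 ^ n * x\<rfloor> = i" "\<lfloor>2 ^ n * r\<rfloor> = j"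
      by (auto simp: T_def)
    have near: "\<bar>a - b\<bar> \<le> 1 / 2 ^ n" if "\<lfloor>2 ^ n * a\<rfloor> = \<lfloor>2 ^ n * b\<rfloor>" for a b :: real
    proof -
      have "2 ^ n * \<bar>a - b\<bar> = \<bar>2 ^ n * a - 2 ^ n * b\<bar>"
        by (simp add: abs_mult flip: right_diff_distrib)
      also have "\<dots> \<le> 1" using that by linarith
      finally show ?thesis by (simp add: field_simps)
    qed
    have "T i j \<subseteq> {(x - h r) - M / 2 ^ n .. (x - h r) + M / 2 ^ n}"
    proof
      fix y assume "y \<in> T i j"
      then obtain x' r' :: real where y: "y = x' - h r'" "r' \<in> J" "\<lfloor>2 ^ n * x'\<rfloor> = i" "\<lfloor>2 ^ n * r'\<rfloor> = j"
        by (auto simp: T_def)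
      have "\<bar>h r' - h r\<bar> \<le> (M - 1) * (1 / 2 ^ n)"
      proof -
        have "\<bar>h r' - h r\<bar> \<le> L * \<bar>r' - r\<bar>" by (rule Lip[OF y(2) xr(1)])
        also have "\<dots> \<le> (M - 1) * (1 / 2 ^ n)"
          using near[of r' r] xr y M by (intro mult_mono) (simp_all add: M_def)
        finally show ?thesis .
      qed
      moreover have "\<bar>x' - x\<bar> \<le> 1 / 2 ^ n" using near[of x' x] xr y by simp
      moreover have "M / 2 ^ n = 1 / 2 ^ n + (M - 1) * (1 / 2 ^ n)" by (simp add: field_simps)
      ultimately show "y \<in> {(x - h r) - M / 2 ^ n .. (x - h r) + M / 2 ^ n}"
        unfolding y(1) atLeastAtMost_iff by linarith
    qed
    then show ?thesis by blast
  qed simp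
  then obtain c where c: "\<And>i j. T i j \<subseteq> {c i j - M / 2 ^ n .. c i j + M / 2 ^ n}"
    by metis
  define S where "S p = {c (fst p) (snd p) - M / 2 ^ n .. c (fst p) (snd p) + M / 2 ^ n}" for p
  have fin: "finite (I \<times> I)" by (simp add: I_def finite_dyadic_indices)
  have meas: "S p \<in> lmeasurable" for p by (simp add: S_def)
  show "\<exists>T. ?B \<subseteq> T \<and> T \<in> lmeasurable \<and> measure lebesgue T \<le> e"
  proof (intro exI conjI)
    show "?B \<subseteq> (\<Union>p\<in>I \<times> I. S p)"
    proof
      fix y assume "y \<in> ?B"
      then obtain a b where ab: "a \<in> Y" "b \<in> Y" "y = Rep_circle a - h (Rep_circle b)" "Rep_circle b \<in> J"
        by blast
      then have "y \<in> T (dyadic_index n a) (dyadic_index n b)"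
        unfolding T_def dyadic_index_def by blast
      then have "y \<in> S (dyadic_index n a, dyadic_index n b)"
        using c unfolding S_def fst_conv snd_conv by blast
      then show "y \<in> (\<Union>p\<in>I \<times> I. S p)" using ab unfolding I_def by blast
    qed
    show "(\<Union>p\<in>I \<times> I. S p) \<in> lmeasurable"
      using fin meas by (intro fmeasurable.finite_UN) simp_all
    have "measure lebesgue (\<Union>p\<in>I \<times> I. S p) \<le> (\<Sum>p\<in>I \<times> I. measure lebesgue (S p))"
      using fin meas by (intro measure_UNION_le) (auto simp: fmeasurableD)
    also have "\<dots> = (\<Sum>p\<in>I \<times> I. 2 * M / 2 ^ n)"
      using M by (intro sum.cong) (simp_all add: S_def)
    also have "\<dots> = real (dyadic_count n Y) ^ 2 * (2 * M / 2 ^ n)"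
      by (simp add: I_def dyadic_count_def card_cartesian_product power2_eq_square)
    also have "\<dots> \<le> (e / (2 * M) * 2 ^ n) * (2 * M / 2 ^ n)"
      using n M by (intro mult_right_mono) simp_all
    also have "\<dots> = e" using M by simp
    finally show "measure lebesgue (\<Union>p\<in>I \<times> I. S p) \<le> e" .
  qed
qed

section \<open>Functions of class \<open>C\<^sup>r\<close>\<close>

lemma Ck_on_mono:
  assumes "Ck_on r S F" "q \<le> r"
  shows "Ck_on q S F"
proof (cases "q = r")
  case False
  with assms have "(deriv ^^ q) F differentiable_on S" "q < r" by (simp_all add: Ck_on_def)
  with assms show ?thesis by (simp add: Ck_on_def differentiable_imp_continuous_on)
qed (use assms in simp)

lemma Ck_on_subset: "Ck_on r S F \<Longrightarrow> T \<subseteq> S \<Longrightarrow> Ck_on r T F"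
  unfolding Ck_on_def by (meson continuous_on_subset differentiable_on_subset)

lemma higher_deriv_diff_Ck_on:
  assumes "open S" "Ck_on r S F" "Ck_on r S G" "k \<le> r" "t \<in> S"
  shows "(deriv ^^ k) (\<lambda>t. F t - G t) t = (deriv ^^ k) F t - (deriv ^^ k) G t"
  using assms(4,5)
proof (induction k arbitrary: t)
  case (Suc k)
  have diff: "(deriv ^^ k) F field_differentiable at t" "(deriv ^^ k) G field_differentiable at t"
    using assms(1-3) Suc.prems unfolding Ck_on_def
    by (auto simp: differentiable_on_eq_differentiable_at field_differentiable_def
        real_differentiable_def Suc_le_eq)
  have "eventually (\<lambda>u. (deriv ^^ k) (\<lambda>t. F t - G t) u = (deriv ^^ k) F u - (deriv ^^ k) G u) (nhds t)"
    using eventually_nhds_in_open[OF assms(1) Suc.prems(2)]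
    by eventually_elim (use Suc in simp)
  then have "deriv ((deriv ^^ k) (\<lambda>t. F t - G t)) t
      = deriv (\<lambda>u. (deriv ^^ k) F u - (deriv ^^ k) G u) t"
    by (rule deriv_cong_ev) simp
  also have "\<dots> = deriv ((deriv ^^ k) F) t - deriv ((deriv ^^ k) G) t"
    by (rule deriv_diff[OF diff])
  finally show ?case by simp
qed simp

lemma Ck_on_diff:
  assumes "open S" "Ck_on r S F" "Ck_on r S G"
  shows "Ck_on r S (\<lambda>t. F t - G t)"
  unfolding Ck_on_def
proof (intro conjI allI impI)
  fix k assume "k < r"
  then have "(\<lambda>t. (deriv ^^ k) F t - (deriv ^^ k) G t) differentiable_on S"
    using assms by (intro differentiable_on_diff) (simp_all add: Ck_on_def)
  moreover have "(deriv ^^ k) (\<lambda>t. F t - G t) t = (deriv ^^ k) F t - (deriv ^^ k) G t"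
    if "t \<in> S" for t
    using \<open>k < r\<close> that by (intro higher_deriv_diff_Ck_on[OF assms]) simp_all
  ultimately show "(deriv ^^ k) (\<lambda>t. F t - G t) differentiable_on S"
    unfolding differentiable_on_def differentiable_def
    by (metis (no_types, lifting) has_derivative_transform)
next
  have "continuous_on S (\<lambda>t. (deriv ^^ r) F t - (deriv ^^ r) G t)"
    using assms by (intro continuous_on_diff) (simp_all add: Ck_on_def)
  then show "continuous_on S ((deriv ^^ r) (\<lambda>t. F t - G t))"
    using higher_deriv_diff_Ck_on[OF assms order_refl]
    by (subst continuous_on_cong[OF refl]) simp_all
qed

lemma deriv_add_const: "deriv (\<lambda>t. F t + c) = deriv F" for F :: "real \<Rightarrow> real"
proof -
  have "((\<lambda>t. F t + c) has_field_derivative D) (at x) \<longleftrightarrow> (F has_field_derivative D) (at x)" for D x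
  proof
    assume "((\<lambda>t. F t + c) has_field_derivative D) (at x)"
    then have "((\<lambda>t. (F t + c) - c) has_field_derivative D - 0) (at x)"
      by (intro DERIV_diff DERIV_const)
    then show "(F has_field_derivative D) (at x)" by simp
  next
    assume "(F has_field_derivative D) (at x)"
    then have "((\<lambda>t. F t + c) has_field_derivative D + 0) (at x)"
      by (intro DERIV_add DERIV_const)
    then show "((\<lambda>t. F t + c) has_field_derivative D) (at x)" by simp
  qed
  then show ?thesis by (simp add: deriv_def fun_eq_iff)
qed

lemma higher_deriv_add_const: "(deriv ^^ Suc k) (\<lambda>t. F t + c) = (deriv ^^ Suc k) F"
  for F :: "real \<Rightarrow> real"
  by (simp add: funpow_Suc_right deriv_add_const del: funpow.simps)

lemma Ck_on_add_const:
  assumes "Ck_on r S F"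
  shows "Ck_on r S (\<lambda>t. F t + c)"
  unfolding Ck_on_def
proof (intro conjI allI impI)
  fix k assume "k < r"
  then have "(deriv ^^ k) F differentiable_on S" using assms by (simp add: Ck_on_def)
  then show "(deriv ^^ k) (\<lambda>t. F t + c) differentiable_on S"
    by (cases k) (simp_all add: higher_deriv_add_const del: funpow.simps)
next
  have "continuous_on S ((deriv ^^ r) F)" using assms by (simp add: Ck_on_def)
  then show "continuous_on S ((deriv ^^ r) (\<lambda>t. F t + c))"
    by (cases r) (simp_all add: higher_deriv_add_const continuous_on_add del: funpow.simps)
qed

lemma locally_Hoelder_on_add_const:
  "locally_Hoelder_on \<beta> S (\<lambda>t. h t + c) \<longleftrightarrow> locally_Hoelder_on \<beta> S h"
  by (simp add: locally_Hoelder_on_def)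

lemma Calpha_on_add_const:
  assumes "Calpha_on \<alpha> S F"
  shows "Calpha_on \<alpha> S (\<lambda>t. F t + c)"
proof -
  have "locally_Hoelder_on \<beta> S ((deriv ^^ r) (\<lambda>t. F t + c))"
    if "locally_Hoelder_on \<beta> S ((deriv ^^ r) F)" for \<beta> r
    using that locally_Hoelder_on_add_const
    by (cases r) (simp_all add: higher_deriv_add_const del: funpow.simps)
  then show ?thesis
    using assms Ck_on_add_const by (auto simp: Calpha_on_def split: if_splits)
qed

lemma deriv_shift: "deriv (\<lambda>t. F (t + a)) = (\<lambda>t. deriv F (t + a))" for F :: "real \<Rightarrow> real"
  by (simp add: deriv_def fun_eq_iff DERIV_shift)

lemma higher_deriv_shift: "(deriv ^^ k) (\<lambda>t. F (t + a)) = (\<lambda>t. (deriv ^^ k) F (t + a))"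
  for F :: "real \<Rightarrow> real"
proof (induction k)
  case (Suc k)
  then show ?case using deriv_shift[of "(deriv ^^ k) F" a] by simp
qed simp

lemma Ck_points_shift:
  assumes "t + a \<in> Ck_points r F"
  shows "t \<in> Ck_points r (\<lambda>t. F (t + a))"
proof -
  obtain S where S: "open S" "t + a \<in> S" "Ck_on r S F" using assms by (auto simp: Ck_points_def)
  define T where "T = (\<lambda>u. u + a) -` S"
  have "open T" unfolding T_def
    by (intro open_vimage S(1) continuous_intros)
  have "Ck_on r T (\<lambda>t. F (t + a))"
    unfolding Ck_on_def higher_deriv_shift
  proof (intro conjI allI impI)
    fix k assume "k < r"
    then have "(deriv ^^ k) F differentiable at (u + a)" if "u \<in> T" for u
      using S that by (auto simp: Ck_on_def T_def differentiable_on_eq_differentiable_at)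
    then show "(\<lambda>t. (deriv ^^ k) F (t + a)) differentiable_on T"
      using \<open>open T\<close>
      by (auto simp: differentiable_on_eq_differentiable_at real_differentiable_def DERIV_shift)
  next
    have "continuous_on S ((deriv ^^ r) F)" using S(3) by (simp add: Ck_on_def)
    moreover have "continuous_on T (\<lambda>t. t + a)" by (intro continuous_intros)
    ultimately show "continuous_on T (\<lambda>t. (deriv ^^ r) F (t + a))"
      by (rule continuous_on_compose2) (auto simp: T_def)
  qed
  with \<open>open T\<close> S(2) show ?thesis by (auto simp: Ck_points_def T_def)
qed

lemma Ck_points_add_const: "Ck_points r F \<subseteq> Ck_points r (\<lambda>t. F t + c)"
  unfolding Ck_points_def using Ck_on_add_const by blast

lemma Ck_points_diff: "Ck_points r F \<inter> Ck_points r G \<subseteq> Ck_points r (\<lambda>t. F t - G t)"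
proof
  fix t assume "t \<in> Ck_points r F \<inter> Ck_points r G"
  then obtain S T where ST: "open S" "t \<in> S" "Ck_on r S F" "open T" "t \<in> T" "Ck_on r T G"
    by (auto simp: Ck_points_def)
  then have "Ck_on r (S \<inter> T) (\<lambda>t. F t - G t)"
    by (intro Ck_on_diff) (auto intro: Ck_on_subset)
  with ST show "t \<in> Ck_points r (\<lambda>t. F t - G t)"
    unfolding Ck_points_def by (auto intro!: exI[of _ "S \<inter> T"])
qed

lemma Ck_points_1_locally_Lipschitz:
  assumes "t \<in> Ck_points 1 F"
  obtains a b L where "a \<in> \<rat>" "b \<in> \<rat>" "t \<in> {a..b}"
    "\<And>x y. x \<in> {a..b} \<Longrightarrow> y \<in> {a..b} \<Longrightarrow> \<bar>F x - F y\<bar> \<le> L * \<bar>x - y\<bar>"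
proof -
  obtain S where S: "open S" "t \<in> S" "Ck_on 1 S F" using assms by (auto simp: Ck_points_def)
  obtain e where e: "0 < e" "ball t e \<subseteq> S" using S by (meson openE)
  obtain a where a: "a \<in> \<rat>" "t - e < a" "a < t"
    using Rats_dense_in_real[of "t - e" t] e(1) by auto
  obtain b where b: "b \<in> \<rat>" "t < b" "b < t + e"
    using Rats_dense_in_real[of t "t + e"] e(1) by auto
  have sub: "{a..b} \<subseteq> S"
  proof
    fix x assume "x \<in> {a..b}"
    then have "x \<in> ball t e" using a b by (auto simp: dist_real_def)
    then show "x \<in> S" using e by blast
  qed
  have cont: "continuous_on {a..b} (deriv F)"
    using S(3) sub by (auto simp: Ck_on_def intro: continuous_on_subset)
  have "bounded (deriv F ` {a..b})"
    by (rule compact_imp_bounded[OF compact_continuous_image[OF cont compact_Icc]])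
  then obtain L where "\<forall>x\<in>{a..b}. norm (deriv F x) \<le> L" by (auto simp: bounded_iff)
  then have L: "norm (deriv F x) \<le> L" if "x \<in> {a..b}" for x using that by blast
  have der: "(F has_field_derivative deriv F x) (at x within {a..b})" if "x \<in> {a..b}" for x
  proof -
    have "F differentiable at x"
      using S sub that by (auto simp: Ck_on_def differentiable_on_eq_differentiable_at)
    then show ?thesis
      by (simp add: DERIV_deriv_iff_real_differentiable has_field_derivative_at_within)
  qed
  show thesis
  proof (rule that[OF a(1) b(1)])
    show "t \<in> {a..b}" using a b by simp
    show "\<bar>F x - F y\<bar> \<le> L * \<bar>x - y\<bar>" if "x \<in> {a..b}" "y \<in> {a..b}" for x y
      using field_differentiable_bound[OF convex_real_interval(5) der L that] by simp
  qed
qed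

section \<open>Lifts of expanding Markov maps\<close>

lemma continuous_Ints_valued_constant:
  fixes h :: "real \<Rightarrow> real"
  assumes "continuous_on UNIV h" "\<And>t. h t \<in> \<int>"
  obtains k :: int where "\<And>t. h t = of_int k"
proof -
  have "h constant_on UNIV"
  proof (rule continuous_discrete_range_constant[OF connected_UNIV assms(1)])
    fix x :: real
    have "1 \<le> norm (h y - h x)" if "h y \<noteq> h x" for y
      using Ints_nonzero_abs_ge1[of "h y - h x"] assms(2) that by simp
    then show "\<exists>e>0. \<forall>y. y \<in> UNIV \<and> h y \<noteq> h x \<longrightarrow> e \<le> norm (h y - h x)"
      using zero_less_one by blast
  qed
  moreover obtain k :: int where "h 0 = of_int k" using assms(2)[of 0] by (elim Ints_cases)
  ultimately have "h t = of_int k" for t unfolding constant_on_def by (metis UNIV_I)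
  then show thesis by (rule that)
qed

lemma is_lift_unique:
  assumes "is_lift f F" "is_lift f G"
  obtains k :: int where "\<And>t. F t = G t + of_int k"
proof -
  have "F t - G t \<in> \<int>" for t
    using assms by (simp add: is_lift_def flip: circ_eq_iff)
  moreover have "continuous_on UNIV (\<lambda>t. F t - G t)"
    using assms by (intro continuous_on_diff) (simp_all add: is_lift_def)
  ultimately obtain k :: int where "\<And>t. F t - G t = of_int k"
    using continuous_Ints_valued_constant[of "\<lambda>t. F t - G t"] by blast
  then show thesis by (intro that[of k]) (simp add: algebra_simps)
qed

lemma is_lift_shift_int:
  assumes "is_lift f F"
  shows "is_lift f (\<lambda>t. F (t + of_int k))"
proof -
  have "continuous_on UNIV (\<lambda>t. F (t + of_int k))"
    by (rule continuous_on_compose2[of UNIV F])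
      (use assms in \<open>auto simp: is_lift_def intro!: continuous_intros\<close>)
  then show ?thesis using assms by (simp add: is_lift_def)
qed

lemma Calpha_on_imp_Ck_on:
  assumes "Calpha_on \<alpha> S F" "\<alpha> = \<infinity> \<or> r \<le> int_order \<alpha>"
  shows "Ck_on r S F"
  using assms Ck_on_mono unfolding Calpha_on_def by (auto split: if_splits)

lemma partition_point:
  fixes t :: "nat \<Rightarrow> real"
  assumes "t 0 \<le> v" "v < t n"
  obtains i where "i < n" "t i \<le> v" "v < t (Suc i)"
proof -
  have "\<exists>i<n. t i \<le> v \<and> v < t (Suc i)"
    using assms(2)
  proof (induction n)
    case 0
    then show ?case using assms(1) by simp
  next
    case (Suc n)
    then show ?case by (metis less_Suc_eq not_le)
  qed
  then show thesis using that by blast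
qed

text \<open>The regularity that the definition grants on one period propagates to the whole line, since a
  translate of a lift by an integer is a lift of the same map and so differs from it by a
  constant.\<close>

lemma countable_singular_points:
  assumes f: "expanding_Markov \<alpha> f" and F: "is_lift f F" and r: "\<alpha> = \<infinity> \<or> r \<le> int_order \<alpha>"
  shows "countable (- Ck_points r F)"
proof -
  obtain G n t where G: "is_lift f G" and t: "t n = t 0 + 1"
    and reg: "\<And>i. i < n \<Longrightarrow> Calpha_on \<alpha> {t i<..<t (Suc i)} G"
    using f unfolding expanding_Markov_def by blast
  have "- Ck_points r F \<subseteq> (\<lambda>(i, k). t i + of_int k) ` ({..<n} \<times> (UNIV :: int set))"
  proof
    fix u assume u: "u \<in> - Ck_points r F"
    define k where "k = \<lfloor>u - t 0\<rfloor>"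
    define v where "v = u - of_int k"
    have "t 0 \<le> v" "v < t n" unfolding v_def k_def t by linarith+
    then obtain i where i: "i < n" "t i \<le> v" "v < t (Suc i)" by (rule partition_point)
    have "v = t i"
    proof (rule ccontr)
      assume "v \<noteq> t i"
      then have "v \<in> {t i<..<t (Suc i)}" using i by simp
      then have "v \<in> Ck_points r G"
        using Calpha_on_imp_Ck_on[OF reg[OF i(1)] r] unfolding Ck_points_def
        by (blast intro: open_greaterThanLessThan)
      then have "u + of_int (- k) \<in> Ck_points r G" by (simp add: v_def)
      then have "u \<in> Ck_points r (\<lambda>t. G (t + of_int (- k)))" by (rule Ck_points_shift)
      moreover obtain d :: int where "\<And>t. F t = G (t + of_int (- k)) + of_int d"
        using is_lift_unique[OF F is_lift_shift_int[OF G, of "- k"]] by blast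
      then have "F = (\<lambda>t. G (t + of_int (- k)) + of_int d)" by (rule ext)
      ultimately have "u \<in> Ck_points r F" using Ck_points_add_const by blast
      with u show False by simp
    qed
    then have "u = t i + of_int k" by (simp add: v_def)
    then show "u \<in> (\<lambda>(i, k). t i + of_int k) ` ({..<n} \<times> (UNIV :: int set))"
      using i(1) by (intro image_eqI[of _ _ "(i, k)"]) simp_all
  qed
  then show ?thesis by (rule countable_subset) (intro countable_image countable_SIGMA; simp)
qed

lemma closure_Compl_countable:
  fixes C :: "real set"
  assumes "countable C"
  shows "closure (- C) = UNIV"
proof -
  have "interior C = {}"
  proof (rule ccontr)
    assume "interior C \<noteq> {}"
    then obtain x e where "0 < e" "ball x e \<subseteq> C" by (metis ex_in_conv mem_interior)
    then show False using assms uncountable_ball countable_subset by blast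
  qed
  then show ?thesis by (simp add: closure_complement)
qed

lemma abs_le_Ck_norm:
  assumes "t \<in> Ck_points r \<phi>"
  shows "ennreal \<bar>\<phi> t\<bar> \<le> Ck_norm r \<phi>"
proof -
  have "ennreal \<bar>\<phi> t\<bar> \<le> (SUP t\<in>Ck_points r \<phi>. ennreal \<bar>(deriv ^^ 0) \<phi> t\<bar>)"
    using assms by (intro SUP_upper2[of t]) simp_all
  also have "\<dots> \<le> Ck_norm r \<phi>"
    unfolding Ck_norm_def by (rule member_le_sum) simp_all
  finally show ?thesis .
qed

text \<open>The norm ignores the singular points, but these are countably many, so by continuity it still
  dominates the uniform distance of the lifts.\<close>

lemma lift_difference_bound:
  assumes f: "expanding_Markov \<alpha> f" "is_lift f F" and g: "expanding_Markov \<alpha> g" "is_lift g G"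
    and norm: "Calpha_norm \<alpha> (\<lambda>t. F t - G t) < ennreal \<epsilon>" and eps: "0 < \<epsilon>" "\<epsilon> \<le> 1"
  shows "\<bar>F t - G t\<bar> \<le> \<epsilon>"
proof -
  let ?\<phi> = "\<lambda>t. F t - G t"
  \<comment> \<open>For \<open>\<alpha> = \<infinity>\<close> the term of index \<open>0\<close> has weight \<open>1\<close>, and since \<open>\<epsilon> \<le> 1\<close> its truncation by
    \<open>min 1\<close> loses nothing.\<close>
  define r where "r = (if \<alpha> = \<infinity> then 0 else int_order \<alpha>)"
  have r: "\<alpha> = \<infinity> \<or> r \<le> int_order \<alpha>" by (simp add: r_def)
  have "Ck_norm r ?\<phi> < ennreal \<epsilon>"
  proof (cases "\<alpha> = \<infinity>")
    case True
    let ?a = "\<lambda>n. ennreal ((1/2) ^ n) * min 1 (Ck_norm n ?\<phi>)"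
    have "min 1 (Ck_norm 0 ?\<phi>) = sum ?a {0}" by simp
    also have "\<dots> \<le> suminf ?a" by (rule sum_le_suminf) simp_all
    also have "\<dots> < ennreal \<epsilon>" using norm True by (simp add: Calpha_norm_def)
    finally have "min 1 (Ck_norm 0 ?\<phi>) < ennreal \<epsilon>" .
    moreover have "ennreal \<epsilon> \<le> 1" using eps by simp
    ultimately show ?thesis using True by (auto simp: r_def min_less_iff_disj)
  next
    case False
    then have "Ck_norm r ?\<phi> \<le> Calpha_norm \<alpha> ?\<phi>" by (simp add: Calpha_norm_def r_def)
    with norm show ?thesis by (rule le_less_trans[rotated])
  qed
  then have bound: "\<bar>?\<phi> u\<bar> \<le> \<epsilon>" if "u \<in> Ck_points r ?\<phi>" for u
    using abs_le_Ck_norm[OF that] eps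
    by (metis abs_ge_zero ennreal_less_iff le_less_trans less_imp_le)
  have "countable (- Ck_points r ?\<phi>)"
  proof (rule countable_subset)
    show "- Ck_points r ?\<phi> \<subseteq> - Ck_points r F \<union> - Ck_points r G" using Ck_points_diff by blast
    show "countable (- Ck_points r F \<union> - Ck_points r G)"
      using countable_singular_points[OF f r] countable_singular_points[OF g r] by simp
  qed
  then have dense: "closure (Ck_points r ?\<phi>) = UNIV" using closure_Compl_countable by fastforce
  have "continuous_on UNIV ?\<phi>"
    using f g by (intro continuous_on_diff) (simp_all add: is_lift_def)
  then have "closed {u. \<bar>?\<phi> u\<bar> \<le> \<epsilon>}"
    by (rule closed_Collect_le[OF continuous_on_rabs continuous_on_const])
  then have "closure (Ck_points r ?\<phi>) \<subseteq> {u. \<bar>?\<phi> u\<bar> \<le> \<epsilon>}"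
    using bound by (intro closure_minimal) auto
  then show ?thesis using dense by blast
qed

lemma dist_le_of_Calpha_dist_less:
  assumes "expanding_Markov \<alpha> f" "expanding_Markov \<alpha> g"
    and "Calpha_dist \<alpha> f g < ennreal \<epsilon>" "0 < \<epsilon>" "\<epsilon> \<le> 1"
  shows "dist (f x) (g x) \<le> \<epsilon>"
proof -
  obtain F G where FG: "is_lift f F" "is_lift g G" "Calpha_norm \<alpha> (\<lambda>t. F t - G t) < ennreal \<epsilon>"
    using assms(3) unfolding Calpha_dist_def INF_less_iff by auto
  let ?r = "Rep_circle x"
  have "f x = circ (F ?r)" "g x = circ (G ?r)" using FG by (simp_all add: is_lift_def)
  then have "dist (f x) (g x) \<le> \<bar>F ?r - G ?r\<bar>" by (simp add: dist_circ_le)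
  also have "\<dots> \<le> \<epsilon>" by (rule lift_difference_bound[OF assms(1) FG(1) assms(2) FG(2,3) assms(4,5)])
  finally show ?thesis .
qed

lemma local_homeomorphism_continuous:
  fixes f :: "'a::t2_space \<Rightarrow> 'b::topological_space"
  assumes "local_homeomorphism f"
  shows "continuous_on UNIV f"
proof -
  have "isCont f x" for x
  proof -
    obtain U V g where "open U" "x \<in> U" "homeomorphism U V f g"
      using assms unfolding local_homeomorphism_def by blast
    then show ?thesis
      using continuous_on_eq_continuous_at homeomorphism_cont1 by blast
  qed
  then show ?thesis by (simp add: continuous_on_eq_continuous_at)
qed

lemma expanding_Markov_open_disjoint:
  assumes "compact Y"
  shows "expanding_Markov_open \<alpha> {f. expanding_Markov \<alpha> f \<and> f ` Y \<inter> Y = {}}"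
  unfolding expanding_Markov_open_def
proof (intro conjI ballI)
  fix f assume "f \<in> {f. expanding_Markov \<alpha> f \<and> f ` Y \<inter> Y = {}}"
  then have f: "expanding_Markov \<alpha> f" "f ` Y \<inter> Y = {}" by simp_all
  have "continuous_on UNIV f"
    using f(1) by (simp add: expanding_Markov_def local_homeomorphism_continuous)
  then have "compact (f ` Y)"
    using assms by (meson compact_continuous_image continuous_on_subset subset_UNIV)
  moreover have "open (- Y)" using assms by (simp add: compact_imp_closed open_Compl)
  moreover have "f ` Y \<subseteq> - Y" using f(2) by blast
  ultimately obtain \<delta> where \<delta>: "0 < \<delta>" "(\<Union>p\<in>f ` Y. ball p \<delta>) \<subseteq> - Y"
    by (rule compact_subset_open_imp_ball_epsilon_subset)
  define \<epsilon> where "\<epsilon> = min 1 (\<delta> / 2)"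
  have \<epsilon>: "0 < \<epsilon>" "\<epsilon> \<le> 1" "\<epsilon> < \<delta>" using \<delta>(1) by (simp_all add: \<epsilon>_def)
  have "g ` Y \<inter> Y = {}" if g: "expanding_Markov \<alpha> g" "Calpha_dist \<alpha> f g < ennreal \<epsilon>" for g
  proof -
    have "g x \<notin> Y" if "x \<in> Y" for x
    proof -
      have "g x \<in> ball (f x) \<delta>"
        using dist_le_of_Calpha_dist_less[OF f(1) g \<epsilon>(1,2), of x] \<epsilon>(3) by simp
      then show ?thesis using \<delta>(2) that by blast
    qed
    then show ?thesis by blast
  qed
  with \<epsilon>(1) show "\<exists>\<epsilon>>0. \<forall>g. expanding_Markov \<alpha> g \<and> Calpha_dist \<alpha> f g < \<epsilon>
      \<longrightarrow> g \<in> {f. expanding_Markov \<alpha> f \<and> f ` Y \<inter> Y = {}}"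
    by (intro exI[of _ "ennreal \<epsilon>"]) simp
qed blast

section \<open>Rotations\<close>

definition rotation :: "real \<Rightarrow> circle \<Rightarrow> circle" where
  "rotation t x = circ (Rep_circle x + t)"

lemma rotation_circ [simp]: "rotation t (circ u) = circ (u + t)"
  by (simp add: rotation_def circ_eq_iff frac_def)

lemma rotation_rotation [simp]: "rotation s (rotation t x) = circ (Rep_circle x + t + s)"
  by (simp add: rotation_def[of t])

lemma rotation_inverse: "rotation (- t) (rotation t x) = x" "rotation t (rotation (- t) x) = x"
  by simp_all

lemma continuous_on_rotation: "continuous_on S (rotation t)"
proof (rule continuous_on_iff[THEN iffD2], intro ballI allI impI)
  fix x e assume "(0 :: real) < e"
  have "dist (rotation t y) (rotation t x) \<le> dist y x" for y
  proof -
    obtain a b where ab: "y = circ a" "x = circ b" "dist y x = \<bar>a - b\<bar>"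
      by (rule dist_circle_attained)
    then show ?thesis using dist_circ_le[of "a + t" "b + t"] by simp
  qed
  then show "\<exists>d>0. \<forall>y\<in>S. dist y x < d \<longrightarrow> dist (rotation t y) (rotation t x) < e"
    using \<open>0 < e\<close> le_less_trans by blast
qed

lemma bij_rotation: "bij (rotation t)"
  by (rule bij_betw_byWitness[where f' = "rotation (- t)"]) (simp_all add: rotation_inverse)

lemma homeomorphism_rotation: "homeomorphism V (rotation t ` V) (rotation t) (rotation (- t))"
  by (rule homeomorphismI)
    (auto simp: continuous_on_rotation rotation_inverse simp del: rotation_rotation)

lemma open_rotation_image:
  assumes "open V"
  shows "open (rotation t ` V)"
proof -
  have "x \<in> rotation t ` V \<longleftrightarrow> rotation (- t) x \<in> V" for x
    by (metis image_iff rotation_inverse)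
  then have "rotation t ` V = rotation (- t) -` V" by blast
  then show ?thesis
    using assms continuous_on_rotation by (simp add: open_vimage)
qed

lemma is_lift_rotation_comp:
  assumes "is_lift f F"
  shows "is_lift (rotation t \<circ> f) (\<lambda>u. F u + t)"
proof -
  have "circ (F u + t) = (rotation t \<circ> f) (circ u)" for u
    using assms by (metis comp_apply is_lift_def rotation_circ)
  moreover have "continuous_on UNIV (\<lambda>u. F u + t)"
    using assms by (intro continuous_on_add continuous_on_const) (simp add: is_lift_def)
  ultimately show ?thesis by (simp add: is_lift_def)
qed

lemma local_homeomorphism_rotation_comp:
  assumes "local_homeomorphism f"
  shows "local_homeomorphism (rotation t \<circ> f)"
  unfolding local_homeomorphism_def
proof
  fix x
  obtain U V g where U: "open U" "x \<in> U" "open V" "homeomorphism U V f g"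
    using assms unfolding local_homeomorphism_def by blast
  have "homeomorphism U (rotation t ` V) (rotation t \<circ> f) (g \<circ> rotation (- t))"
    by (rule homeomorphism_compose[OF U(4) homeomorphism_rotation])
  with U open_rotation_image[OF U(3)]
  show "\<exists>U V g. open U \<and> x \<in> U \<and> open V \<and> homeomorphism U V (rotation t \<circ> f) g"
    by blast
qed

lemma expanding_Markov_rotation_comp:
  assumes "expanding_Markov \<alpha> f"
  shows "expanding_Markov \<alpha> (rotation c \<circ> f)"
proof -
  obtain F n t \<gamma> where F: "local_homeomorphism f" "is_lift f F" "0 < n"
    "\<forall>i<n. t i < t (Suc i)" "t n = t 0 + 1" "1 < \<gamma>"
    and pieces: "\<forall>i<n. bij_betw f (circ ` {t i..<t (Suc i)}) UNIV \<and>
       Calpha_on \<alpha> {t i<..<t (Suc i)} F \<and> (\<forall>s\<in>{t i<..<t (Suc i)}. \<gamma> < \<bar>deriv F s\<bar>)"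
    using assms unfolding expanding_Markov_def by blast
  have "\<forall>i<n. bij_betw (rotation c \<circ> f) (circ ` {t i..<t (Suc i)}) UNIV \<and>
       Calpha_on \<alpha> {t i<..<t (Suc i)} (\<lambda>u. F u + c) \<and>
       (\<forall>s\<in>{t i<..<t (Suc i)}. \<gamma> < \<bar>deriv (\<lambda>u. F u + c) s\<bar>)"
    using pieces by (auto intro: bij_betw_trans[OF _ bij_rotation] Calpha_on_add_const
        simp: deriv_add_const)
  then show ?thesis
    unfolding expanding_Markov_def
    using F local_homeomorphism_rotation_comp is_lift_rotation_comp[OF F(2), of c] by blast
qed

lemma higher_deriv_const: "(deriv ^^ k) (\<lambda>_. c) = (\<lambda>_. if k = 0 then c else 0)" for c :: real
  by (induction k) simp_all

lemma Ck_norm_const_le: "Ck_norm r (\<lambda>_. c) \<le> ennreal \<bar>c\<bar>"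
proof -
  have "Ck_norm r (\<lambda>_. c) \<le> (\<Sum>k\<le>r. if k = 0 then ennreal \<bar>c\<bar> else 0)"
    unfolding Ck_norm_def by (intro sum_mono SUP_least) (simp add: higher_deriv_const)
  also have "\<dots> = ennreal \<bar>c\<bar>" by simp
  finally show ?thesis .
qed

text \<open>The factor \<open>2\<close> is the sum of the weights \<open>2 ^ - n\<close> in the case \<open>\<alpha> = \<infinity>\<close>.\<close>

lemma Calpha_norm_const_le: "Calpha_norm \<alpha> (\<lambda>_. c) \<le> ennreal (2 * \<bar>c\<bar>)"
proof (cases "\<alpha> = \<infinity>")
  case True
  have "ennreal ((1/2) ^ n) * min 1 (Ck_norm n (\<lambda>_. c)) \<le> ennreal ((1/2) ^ n * \<bar>c\<bar>)" for n
    unfolding ennreal_mult''[OF abs_ge_zero]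
    by (intro mult_left_mono min.coboundedI2 Ck_norm_const_le) simp
  then have "Calpha_norm \<alpha> (\<lambda>_. c) \<le> (\<Sum>n. ennreal ((1/2) ^ n * \<bar>c\<bar>))"
    unfolding Calpha_norm_def using True by (auto intro: suminf_le)
  also have "\<dots> = ennreal (2 * \<bar>c\<bar>)"
    using sums_mult2[OF geometric_sums[of "1 / 2 :: real"], of "\<bar>c\<bar>"]
    by (intro suminf_ennreal_eq) simp_all
  finally show ?thesis .
next
  case False
  have "Hoelder_seminorm r \<beta> (\<lambda>_. c) = 0" for r \<beta>
    unfolding Hoelder_seminorm_def by (auto intro!: antisym SUP_least simp: higher_deriv_const)
  then have "Calpha_norm \<alpha> (\<lambda>_. c) = Ck_norm (int_order \<alpha>) (\<lambda>_. c)"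
    using False by (simp add: Calpha_norm_def)
  also have "\<dots> \<le> ennreal \<bar>c\<bar>" by (rule Ck_norm_const_le)
  also have "\<dots> \<le> ennreal (2 * \<bar>c\<bar>)" by (simp add: ennreal_leI)
  finally show ?thesis .
qed

lemma Calpha_dist_rotation_le:
  assumes "is_lift f F"
  shows "Calpha_dist \<alpha> f (rotation t \<circ> f) \<le> ennreal (2 * \<bar>t\<bar>)"
proof -
  have "Calpha_dist \<alpha> f (rotation t \<circ> f) \<le> Calpha_norm \<alpha> (\<lambda>u. F u - (F u + t))"
    unfolding Calpha_dist_def
    by (rule INF_lower2[of "(F, \<lambda>u. F u + t)"]) (use assms is_lift_rotation_comp in auto)
  also have "\<dots> \<le> ennreal (2 * \<bar>t\<bar>)" using Calpha_norm_const_le[of \<alpha> "- t"] by simp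
  finally show ?thesis .
qed

section \<open>Genericity\<close>

text \<open>A rotation by \<open>t\<close> is bad only if \<open>t = x - (F r + k)\<close> with \<open>x\<close>, \<open>r\<close> representing points of
  \<open>Y\<close> and \<open>k\<close> an integer. The derivative of \<open>F\<close> may be unbounded near the singular points, so that
  \<open>F\<close> need not be Lipschitz; but the line is a countable union of intervals and points on each of
  which \<open>F\<close> is.\<close>

lemma negligible_bad_rotations:
  assumes f: "expanding_Markov \<alpha> f" "is_lift f F" and "1 < \<alpha>"
    and small: "\<And>\<delta>. 0 < \<delta> \<Longrightarrow> \<exists>n. real (dyadic_count n Y) ^ 2 < \<delta> * 2 ^ n"
  shows "negligible {t. (rotation t \<circ> f) ` Y \<inter> Y \<noteq> {}}" (is "negligible ?B")
proof -
  have order: "\<alpha> = \<infinity> \<or> 1 \<le> int_order \<alpha>"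
  proof (cases \<alpha>)
    case (real a)
    then have "1 < a" using \<open>1 < \<alpha>\<close> by simp
    then have "1 \<le> \<lfloor>a\<rfloor>" by linarith
    then show ?thesis using real by (simp add: int_order_def le_nat_iff)
  qed (use \<open>1 < \<alpha>\<close> in simp_all)
  define C where "C = - Ck_points 1 F"
  have "countable C" unfolding C_def by (rule countable_singular_points[OF f order])
  define \<J> where "\<J> = {J \<in> (\<lambda>(a, b). {a..b}) ` (\<rat> \<times> \<rat>) \<union> (\<lambda>p. {p}) ` C.
    \<exists>L. \<forall>r\<in>J. \<forall>r'\<in>J. \<bar>F r - F r'\<bar> \<le> L * \<bar>r - r'\<bar>}"
  have "countable ((\<lambda>(a, b). {a..b}) ` (\<rat> \<times> \<rat>) \<union> (\<lambda>p. {p}) ` C)"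
    using \<open>countable C\<close> countable_rat by (intro countable_Un countable_image countable_SIGMA)
  then have "countable \<J>" unfolding \<J>_def by (rule countable_subset[rotated]) blast
  have covers: "\<exists>J\<in>\<J>. r \<in> J" for r
  proof (cases "r \<in> C")
    case True
    then have "{r} \<in> \<J>" unfolding \<J>_def by simp
    then show ?thesis by blast
  next
    case False
    then have "r \<in> Ck_points 1 F" by (simp add: C_def)
    then obtain a b L where "a \<in> \<rat>" "b \<in> \<rat>" "r \<in> {a..b}"
      "\<And>x y. x \<in> {a..b} \<Longrightarrow> y \<in> {a..b} \<Longrightarrow> \<bar>F x - F y\<bar> \<le> L * \<bar>x - y\<bar>"
      by (rule Ck_points_1_locally_Lipschitz) (rule that)
    then have "{a..b} \<in> \<J>" "r \<in> {a..b}" unfolding \<J>_def by blast+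
    then show ?thesis by blast
  qed
  define D where "D p = {x - (F r + of_int (snd p)) | x r.
      x \<in> Rep_circle ` Y \<and> r \<in> Rep_circle ` Y \<inter> fst p}"
    for p :: "real set \<times> int"
  have "negligible (D p)" if "p \<in> \<J> \<times> UNIV" for p
  proof -
    have "fst p \<in> \<J>" using that by auto
    then have "\<exists>L. \<forall>r\<in>fst p. \<forall>r'\<in>fst p. \<bar>F r - F r'\<bar> \<le> L * \<bar>r - r'\<bar>"
      unfolding \<J>_def mem_Collect_eq by (rule conjunct2)
    then obtain L where "\<forall>r\<in>fst p. \<forall>r'\<in>fst p. \<bar>F r - F r'\<bar> \<le> L * \<bar>r - r'\<bar>" ..
    then show ?thesis
      unfolding D_def by (intro negligible_Lipschitz_differences[OF small]) auto
  qed
  then have "negligible (\<Union>(D ` (\<J> \<times> UNIV)))"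
    using \<open>countable \<J>\<close> by (intro negligible_countable_Union countable_image countable_SIGMA) auto
  moreover have "?B \<subseteq> \<Union>(D ` (\<J> \<times> UNIV))"
  proof
    fix t assume "t \<in> ?B"
    then obtain x y where xy: "x \<in> Y" "y \<in> Y" "rotation t (f y) = x" by auto
    have "f y = circ (F (Rep_circle y))" using f(2) unfolding is_lift_def by (metis circ_Rep_circle)
    then have "circ (Rep_circle x) = circ (F (Rep_circle y) + t)" using xy(3) by simp
    then obtain k :: int where "Rep_circle x - (F (Rep_circle y) + t) = of_int k"
      unfolding circ_eq_iff by (elim Ints_cases)
    then have t: "t = Rep_circle x - (F (Rep_circle y) + of_int k)" by simp
    obtain J where "J \<in> \<J>" "Rep_circle y \<in> J" using covers by blast
    with t xy have "t \<in> D (J, k)" unfolding D_def by auto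
    with \<open>J \<in> \<J>\<close> show "t \<in> \<Union>(D ` (\<J> \<times> UNIV))" by blast
  qed
  ultimately show ?thesis by (rule negligible_subset)
qed

text \<open>The bad angles form a null set, so there are arbitrarily small good ones, and a rotation by
  \<open>t\<close> moves a map by at most \<open>2 * \<bar>t\<bar>\<close>.\<close>

lemma dense_disjoint:
  assumes "1 < \<alpha>"
    and small: "\<And>\<delta>. 0 < \<delta> \<Longrightarrow> \<exists>n. real (dyadic_count n Y) ^ 2 < \<delta> * 2 ^ n"
  shows "expanding_Markov_space \<alpha> closure_of {f. expanding_Markov \<alpha> f \<and> f ` Y \<inter> Y = {}}
    = topspace (expanding_Markov_space \<alpha>)"
  unfolding dense_intersects_open
proof (intro allI impI, elim conjE)
  fix U assume U: "openin (expanding_Markov_space \<alpha>) U" "U \<noteq> {}"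
  then obtain f where "f \<in> U" by blast
  with U(1) have f: "expanding_Markov \<alpha> f"
    and "\<exists>\<epsilon>>0. \<forall>g. expanding_Markov \<alpha> g \<and> Calpha_dist \<alpha> f g < \<epsilon> \<longrightarrow> g \<in> U"
    unfolding openin_expanding_Markov_space expanding_Markov_open_def by auto
  then obtain \<epsilon> where \<epsilon>: "0 < \<epsilon>"
    "\<And>g. expanding_Markov \<alpha> g \<Longrightarrow> Calpha_dist \<alpha> f g < \<epsilon> \<Longrightarrow> g \<in> U" by blast
  obtain e where e: "0 < ennreal e" "ennreal e < \<epsilon>"
    using dense[OF \<epsilon>(1)] by (metis ennreal_cases less_top order_less_trans)
  obtain F where F: "is_lift f F" using f unfolding expanding_Markov_def by blast
  have "\<not> negligible {0<..<e / 2}"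
    using e(1) by (intro open_not_negligible) (simp_all add: ennreal_less_zero_iff)
  then have "\<not> {0<..<e / 2} \<subseteq> {t. (rotation t \<circ> f) ` Y \<inter> Y \<noteq> {}}"
    using negligible_subset[OF negligible_bad_rotations[OF f F assms(1) small]] by blast
  then obtain t where t: "0 < t" "t < e / 2" "(rotation t \<circ> f) ` Y \<inter> Y = {}" by auto
  let ?g = "rotation t \<circ> f"
  have g: "expanding_Markov \<alpha> ?g" by (rule expanding_Markov_rotation_comp[OF f])
  have "Calpha_dist \<alpha> f ?g \<le> ennreal (2 * \<bar>t\<bar>)" by (rule Calpha_dist_rotation_le[OF F])
  also have "\<dots> \<le> ennreal e" using t by (intro ennreal_leI) simp
  also note e(2)
  finally have "?g \<in> U" by (intro \<epsilon>(2) g)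
  with g t(3) show "{f. expanding_Markov \<alpha> f \<and> f ` Y \<inter> Y = {}} \<inter> U \<noteq> {}" by blast
qed

text \<open>It is enough to constrain the blocks at all positions by a finite set of words; the pairs
  \<open>(n, W)\<close> with \<open>W\<close> finite are countable, unlike the invariant compact sets.\<close>

definition dyadic_subshift :: "nat \<Rightarrow> int set \<Rightarrow> circle set" where
  "dyadic_subshift n W = {x. \<forall>j. dyadic_index n ((doubling ^^ j) x) \<in> W}"

lemma dyadic_subshift_invariant: "doubling ` dyadic_subshift n W \<subseteq> dyadic_subshift n W"
proof (rule image_subsetI)
  fix x assume "x \<in> dyadic_subshift n W"
  then have "dyadic_index n ((doubling ^^ Suc j) x) \<in> W" for j unfolding dyadic_subshift_def by blast
  then show "doubling x \<in> dyadic_subshift n W"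
    by (simp add: dyadic_subshift_def funpow_Suc_right del: funpow.simps)
qed

lemma subset_dyadic_subshift:
  assumes "doubling ` K \<subseteq> K"
  shows "K \<subseteq> dyadic_subshift n (dyadic_index n ` K)"
  using doubling_iterate_invariant[OF assms] by (auto simp: dyadic_subshift_def)

text \<open>There are at most \<open>card W ^ j\<close> words of length \<open>n * j\<close>, so the relevant ratio is at most
  \<open>25 * (card W ^ 2 / 2 ^ n) ^ j\<close>. This is where dimension \<open>1/2\<close> is critical: the base has to be
  less than \<open>1\<close>. The constant \<open>25\<close> is the square of the \<open>5\<close> lost in passing to the closure.\<close>

lemma dyadic_count_closure_subshift_small:
  assumes "finite W" "card W ^ 2 < 2 ^ n" and \<delta>: "0 < (\<delta> :: real)"
  shows "\<exists>N. real (dyadic_count N (closure (dyadic_subshift n W))) ^ 2 < \<delta> * 2 ^ N"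
proof -
  let ?X = "dyadic_subshift n W"
  define q where "q = real (card W) ^ 2 / 2 ^ n"
  have "real (card W ^ 2) < real (2 ^ n)" using assms(2) unfolding of_nat_less_iff .
  then have q: "q < 1" by (simp add: q_def)
  obtain j where j: "q ^ j < \<delta> / 25" using real_arch_pow_inv[OF _ q, of "\<delta> / 25"] \<delta> by auto
  have "dyadic_index n ` ?X \<subseteq> W"
    unfolding dyadic_subshift_def by (auto dest: spec[of _ 0])
  then have "dyadic_count n ?X \<le> card W"
    unfolding dyadic_count_def using assms(1) by (rule card_mono[rotated])
  then have "dyadic_count n ?X ^ j \<le> card W ^ j" by (rule power_mono) simp
  then have "dyadic_count (n * j) (closure ?X) \<le> 5 * card W ^ j"
    using dyadic_count_closure[of "n * j" ?X]
      dyadic_count_mult[OF dyadic_subshift_invariant, of n j n W] by linarith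
  then have "real (dyadic_count (n * j) (closure ?X)) ^ 2 \<le> real (5 * card W ^ j) ^ 2"
    by (intro power_mono) (simp_all only: of_nat_le_iff of_nat_0_le_iff)
  also have "\<dots> = 25 * q ^ j * 2 ^ (n * j)"
    by (simp add: q_def power_divide power_mult_distrib power_mult[symmetric] mult.commute)
  also have "\<dots> < \<delta> * 2 ^ (n * j)" using j by simp
  finally show ?thesis by blast
qed

theorem theorem6:
  fixes \<alpha> :: ereal
  assumes "1 < \<alpha>"
  shows "\<exists>R. residual_in (expanding_Markov_space \<alpha>) R \<and>
           (\<forall>f\<in>R. \<forall>K\<in>doubling_invariant_compacts.
              hausdorff_dim K < 1/2 \<longrightarrow> f ` K \<inter> K = {})"
proof -
  let ?X = "expanding_Markov_space \<alpha>"
  define P :: "(nat \<times> int set) set" where "P = {(n, W). finite W \<and> card W ^ 2 < 2 ^ n}"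
  define Y where "Y = (\<lambda>(n, W). closure (dyadic_subshift n W))"
  define V where "V p = {f. expanding_Markov \<alpha> f \<and> f ` Y p \<inter> Y p = {}}" for p
  define R where "R = topspace ?X \<inter> \<Inter>(V ` P)"
  have "countable P"
  proof (rule countable_subset)
    show "P \<subseteq> UNIV \<times> Collect finite" by (auto simp: P_def)
    show "countable (UNIV \<times> (Collect finite :: int set set) :: (nat \<times> int set) set)"
      by (intro countable_SIGMA countable_Collect_finite) simp
  qed
  have open_dense: "openin ?X (V p) \<and> ?X closure_of V p = topspace ?X" if "p \<in> P" for p
  proof
    show "openin ?X (V p)"
      unfolding V_def openin_expanding_Markov_space Y_def case_prod_unfold
      by (rule expanding_Markov_open_disjoint[OF compact_closure_circle])
    have "\<exists>N. real (dyadic_count N (Y p)) ^ 2 < \<delta> * 2 ^ N" if "0 < \<delta>" for \<delta>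
      using dyadic_count_closure_subshift_small[OF _ _ that] \<open>p \<in> P\<close> by (auto simp: Y_def P_def)
    then show "?X closure_of V p = topspace ?X"
      unfolding V_def by (rule dense_disjoint[OF assms])
  qed
  have "residual_in ?X R"
    unfolding residual_in_def
    using open_dense \<open>countable P\<close> by (intro conjI exI[of _ "V ` P"]) (auto simp: R_def)
  moreover have "f ` K \<inter> K = {}"
    if f: "f \<in> R" and K: "K \<in> doubling_invariant_compacts" "hausdorff_dim K < 1/2" for f K
  proof -
    obtain n where n: "dyadic_count n K ^ 2 < 2 ^ n" by (rule dyadic_count_below_sqrt[OF K])
    let ?p = "(n, dyadic_index n ` K)"
    have "?p \<in> P" using n finite_dyadic_indices by (simp add: P_def dyadic_count_def)
    then have "f ` Y ?p \<inter> Y ?p = {}" using f by (auto simp: R_def V_def)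
    moreover have "K \<subseteq> Y ?p"
      using K(1) subset_dyadic_subshift[of K n] closure_subset
      unfolding Y_def doubling_invariant_compacts_def by fastforce
    ultimately show ?thesis by blast
  qed
  ultimately show ?thesis by blast
qed

end
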